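(* There is no order function $q\colon \mathbb{N} \to (1,\infty)$ such that $\mathrm{LUA}_{\mathrm{slow}} \equiv_{\mathrm{w}} \mathrm{LUA}(q)$.
   Context: An order function is a computable (i.e. its values are uniformly computable reals), nondecreasing, unbounded function $\mathbb{N}\to\mathbb{R}$. An order function $q\colon\mathbb{N}\to(1,\infty)$ is slow-growing if $\sum_{n=0}^\infty q(n)^{-1}=\infty$. A partial recursive $\psi\colon\subseteq\mathbb{N}\to\mathbb{N}$ is linearly universal if for every partial recursive $\theta\colon\subseteq\mathbb{N}\to\mathbb{N}$ there are $a,b\in\mathbb{N}$ with $\psi(ax+b)\simeq\theta(x)$ for all $x$. For $p\colon\mathbb{N}\to(1,\infty)$, $\mathrm{LUA}(p)$ is the set of $X\in\mathbb{N}^{\mathbb{N}}$ such that $X(n)<p(n)$ for all $n$ and, for some linearly universal partial recursive $\psi$, there is no $n\in\operatorname{dom}\psi$ with $X(n)=\psi(n)$. $\mathrm{LUA}_{\mathrm{slow}}=\bigcup\{\mathrm{LUA}(q) : q\colon\mathbb{N}\to(1,\infty)\text{ a slow-growing order function}\}$. For $P,Q\subseteq\mathbb{N}^{\mathbb{N}}$, $P\leq_{\mathrm{w}}Q$ means every $Y\in Q$ Turing-computes some $X\in P$; $P\equiv_{\mathrm{w}}Q$ means $P\leq_{\mathrm{w}}Q$ and $Q\leq_{\mathrm{w}}P$. *)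

theory Defs
  imports Complex_Main "HOL-Library.Nat_Bijection"
begin

text \<open>
  Partial recursiveness relative to a set \<open>B\<close> of total oracle functions, in unary form: a function of
  several arguments is represented by a function of the Cantor code \<^const>\<open>prod_encode\<close> of the
  arguments, and divergence is \<^const>\<open>None\<close>. Composition and pairing are strict.
\<close>

definition pair_fun :: "(nat \<rightharpoonup> nat) \<Rightarrow> (nat \<rightharpoonup> nat) \<Rightarrow> (nat \<rightharpoonup> nat)" where
  "pair_fun f g x = Option.bind (f x) (\<lambda>a. Option.bind (g x) (\<lambda>b. Some (prod_encode (a, b))))"

definition comp_fun :: "(nat \<rightharpoonup> nat) \<Rightarrow> (nat \<rightharpoonup> nat) \<Rightarrow> (nat \<rightharpoonup> nat)" where
  "comp_fun f g x = Option.bind (g x) f"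

fun prec_aux :: "(nat \<rightharpoonup> nat) \<Rightarrow> (nat \<rightharpoonup> nat) \<Rightarrow> nat \<Rightarrow> nat \<Rightarrow> nat option" where
  "prec_aux f g a 0 = f a"
| "prec_aux f g a (Suc m) =
     Option.bind (prec_aux f g a m) (\<lambda>v. g (prod_encode (a, prod_encode (m, v))))"

definition prec_fun :: "(nat \<rightharpoonup> nat) \<Rightarrow> (nat \<rightharpoonup> nat) \<Rightarrow> (nat \<rightharpoonup> nat)" where
  "prec_fun f g x = (case prod_decode x of (a, n) \<Rightarrow> prec_aux f g a n)"

text \<open>Unbounded search: all values before the first zero must be defined.\<close>

definition is_first_zero :: "(nat \<rightharpoonup> nat) \<Rightarrow> nat \<Rightarrow> nat \<Rightarrow> bool" where
  "is_first_zero f a n \<longleftrightarrow> f (prod_encode (a, n)) = Some 0 \<and>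
     (\<forall>m<n. \<exists>v. f (prod_encode (a, m)) = Some (Suc v))"

definition mu_fun :: "(nat \<rightharpoonup> nat) \<Rightarrow> (nat \<rightharpoonup> nat)" where
  "mu_fun f a = (if \<exists>n. is_first_zero f a n then Some (THE n. is_first_zero f a n) else None)"

inductive partial_recursive_in :: "(nat \<Rightarrow> nat) set \<Rightarrow> (nat \<rightharpoonup> nat) \<Rightarrow> bool" for B where
  zero: "partial_recursive_in B (\<lambda>x. Some 0)"
| succ: "partial_recursive_in B (\<lambda>x. Some (Suc x))"
| left: "partial_recursive_in B (\<lambda>x. Some (fst (prod_decode x)))"
| right: "partial_recursive_in B (\<lambda>x. Some (snd (prod_decode x)))"
| oracle_call: "Y \<in> B \<Longrightarrow> partial_recursive_in B (\<lambda>x. Some (Y x))"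
| pair: "partial_recursive_in B f \<Longrightarrow> partial_recursive_in B g \<Longrightarrow> partial_recursive_in B (pair_fun f g)"
| comp: "partial_recursive_in B f \<Longrightarrow> partial_recursive_in B g \<Longrightarrow> partial_recursive_in B (comp_fun f g)"
| prec: "partial_recursive_in B f \<Longrightarrow> partial_recursive_in B g \<Longrightarrow> partial_recursive_in B (prec_fun f g)"
| mu: "partial_recursive_in B f \<Longrightarrow> partial_recursive_in B (mu_fun f)"

definition partial_recursive :: "(nat \<rightharpoonup> nat) \<Rightarrow> bool" where
  "partial_recursive \<psi> \<longleftrightarrow> partial_recursive_in {} \<psi>"

definition total_recursive :: "(nat \<Rightarrow> nat) \<Rightarrow> bool" where
  "total_recursive f \<longleftrightarrow> partial_recursive (\<lambda>x. Some (f x))"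

definition turing_computes :: "(nat \<Rightarrow> nat) \<Rightarrow> (nat \<Rightarrow> nat) \<Rightarrow> bool" where
  "turing_computes Y X \<longleftrightarrow> partial_recursive_in {Y} (\<lambda>x. Some (X x))"

text \<open>Uniformly computable reals: a recursive double sequence of rationals \<open>(a - b) / (c + 1)\<close>
  approximates the \<open>n\<close>-th real to within \<open>2\<^sup>-\<^sup>k\<close>.\<close>

definition uniformly_computable_reals :: "(nat \<Rightarrow> real) \<Rightarrow> bool" where
  "uniformly_computable_reals q \<longleftrightarrow>
     (\<exists>a b c :: nat \<Rightarrow> nat. total_recursive a \<and> total_recursive b \<and> total_recursive c \<and>
       (\<forall>n k. \<bar>q n - (real (a (prod_encode (n, k))) - real (b (prod_encode (n, k))))
                       / (real (c (prod_encode (n, k))) + 1)\<bar> \<le> 1 / 2 ^ k))"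

definition order_function :: "(nat \<Rightarrow> real) \<Rightarrow> bool" where
  "order_function q \<longleftrightarrow> uniformly_computable_reals q \<and> mono q \<and> (\<forall>r. \<exists>n. r < q n)"

definition slow_growing :: "(nat \<Rightarrow> real) \<Rightarrow> bool" where
  "slow_growing q \<longleftrightarrow> filterlim (\<lambda>N. \<Sum>n<N. inverse (q n)) at_top sequentially"

definition linearly_universal :: "(nat \<rightharpoonup> nat) \<Rightarrow> bool" where
  "linearly_universal \<psi> \<longleftrightarrow> partial_recursive \<psi> \<and>
     (\<forall>\<theta>. partial_recursive \<theta> \<longrightarrow> (\<exists>a b. \<forall>x. \<psi> (a * x + b) = \<theta> x))"

definition LUA :: "(nat \<Rightarrow> real) \<Rightarrow> (nat \<Rightarrow> nat) set" where
  "LUA p = {X. (\<forall>n. real (X n) < p n) \<and>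
     (\<exists>\<psi>. linearly_universal \<psi> \<and> \<not> (\<exists>n \<in> dom \<psi>. \<psi> n = Some (X n)))}"

definition LUA_slow :: "(nat \<Rightarrow> nat) set" where
  "LUA_slow = \<Union> {LUA q |q. order_function q \<and> (\<forall>n. 1 < q n) \<and> slow_growing q}"

definition weakly_reducible :: "(nat \<Rightarrow> nat) set \<Rightarrow> (nat \<Rightarrow> nat) set \<Rightarrow> bool" (infix "\<le>\<^sub>w" 50) where
  "P \<le>\<^sub>w Q \<longleftrightarrow> (\<forall>Y\<in>Q. \<exists>X\<in>P. turing_computes Y X)"

definition weakly_equivalent :: "(nat \<Rightarrow> nat) set \<Rightarrow> (nat \<Rightarrow> nat) set \<Rightarrow> bool" (infix "\<equiv>\<^sub>w" 50) where
  "P \<equiv>\<^sub>w Q \<longleftrightarrow> P \<le>\<^sub>w Q \<and> Q \<le>\<^sub>w P"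

end

theory Submission imports Defs
begin

text \<open>
  For every uniformly computable \<open>p\<close> there are a slow-growing order function \<open>q\<close> and an \<open>X \<in> LUA q\<close>
  that computes no element of \<open>LUA p\<close>, so that \<open>LUA p\<close> is not weakly reducible to \<^const>\<open>LUA_slow\<close>. The
  function \<open>q\<close> is constant on intervals as long as its value there, which makes the sum of its reciprocals
  diverge, but its jumps between intervals outgrow \<open>p\<close> at every argument that matters.

  The sequence \<open>X\<close> is built by forcing with bushy trees (Greenberg--Miller, Khan--Miller). A condition is a
  string \<open>\<sigma>\<close> with a set \<open>B\<close> of forbidden extensions for which no \<open>k\<close>-bushy tree above \<open>\<sigma>\<close> has all its leaves
  in \<open>B\<close>. Given a functional \<open>\<Phi>\<close> and a linearly universal \<open>\<psi>\<close>, a partial recursive \<open>\<theta>\<close> searches for a value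
  \<open>v\<close> and a \<open>k\<close>-bushy tree above \<open>\<sigma>\<close> whose leaves \<open>\<tau>\<close> satisfy \<open>\<Phi>\<^sup>\<tau>(a x + b) = v\<close>; the input \<open>x\<close> codes \<open>a\<close>, \<open>b\<close>,
  \<open>k\<close> and \<open>\<sigma>\<close>, so \<open>\<theta>\<close> knows the place \<open>a x + b\<close> where \<open>\<psi>\<close> repeats its output \<open>\<theta>(x)\<close>. If the search succeeds,
  some leaf extends the condition and \<open>\<Phi>\<^sup>X\<close> agrees with \<open>\<psi>\<close> at \<open>a x + b\<close>. Otherwise, for every \<open>v < p(a x + b)\<close>
  the strings forcing the value \<open>v\<close> can be forbidden, because \<open>q\<close> is large beyond \<open>\<sigma>\<close>.
\<close>

subsection \<open>Closure properties of the recursive functions\<close>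

abbreviation pi1 :: "nat \<Rightarrow> nat" where "pi1 z \<equiv> fst (prod_decode z)"
abbreviation pi2 :: "nat \<Rightarrow> nat" where "pi2 z \<equiv> snd (prod_decode z)"
abbreviation pr :: "nat \<Rightarrow> nat \<Rightarrow> nat" where "pr a b \<equiv> prod_encode (a, b)"

definition decidable :: "(nat \<Rightarrow> bool) \<Rightarrow> bool" where
  "decidable P \<longleftrightarrow> total_recursive (\<lambda>x. if P x then 1 else 0)"

named_theorems recursive_intros

lemma total_recursive_comp:
  assumes "total_recursive f" "total_recursive g"
  shows "total_recursive (\<lambda>x. f (g x))"
  using partial_recursive_in.comp[OF assms[unfolded total_recursive_def partial_recursive_def]]
  by (simp add: total_recursive_def partial_recursive_def comp_fun_def[abs_def])

lemma total_recursive_Suc [recursive_intros]: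
  "total_recursive f \<Longrightarrow> total_recursive (\<lambda>x. Suc (f x))"
  by (rule total_recursive_comp[of Suc])
    (simp_all add: total_recursive_def partial_recursive_def partial_recursive_in.succ)

lemma total_recursive_pi1 [recursive_intros]:
  "total_recursive f \<Longrightarrow> total_recursive (\<lambda>x. pi1 (f x))"
  by (rule total_recursive_comp[of pi1])
    (simp_all add: total_recursive_def partial_recursive_def partial_recursive_in.left)

lemma total_recursive_pi2 [recursive_intros]:
  "total_recursive f \<Longrightarrow> total_recursive (\<lambda>x. pi2 (f x))"
  by (rule total_recursive_comp[of pi2])
    (simp_all add: total_recursive_def partial_recursive_def partial_recursive_in.right)

lemma total_recursive_pair [recursive_intros]:
  assumes "total_recursive f" "total_recursive g"
  shows "total_recursive (\<lambda>x. pr (f x) (g x))"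
  using partial_recursive_in.pair[OF assms[unfolded total_recursive_def partial_recursive_def]]
  by (simp add: total_recursive_def partial_recursive_def pair_fun_def[abs_def])

lemma total_recursive_id [recursive_intros]: "total_recursive (\<lambda>x. x)"
proof -
  have "total_recursive (\<lambda>x. pr (pi1 x) (pi2 x))"
    by (rule total_recursive_pair)
      (simp_all add: total_recursive_def partial_recursive_def
        partial_recursive_in.left partial_recursive_in.right)
  then show ?thesis by simp
qed

lemma total_recursive_const [recursive_intros]: "total_recursive (\<lambda>x. c)"
proof (induction c)
  case 0
  show ?case by (simp add: total_recursive_def partial_recursive_def partial_recursive_in.zero)
next
  case (Suc c)
  then show ?case by (rule total_recursive_Suc)
qed

text \<open>The step function may depend on the parameter, which enters as the first component of
  the coded triple. Arithmetic, case distinction and counting below are instances of this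
  scheme.\<close>

lemma total_recursive_rec_nat [recursive_intros]:
  assumes f: "total_recursive f"
    and g: "total_recursive (\<lambda>z. g (pi1 z) (pi1 (pi2 z)) (pi2 (pi2 z)))"
    and n: "total_recursive n"
  shows "total_recursive (\<lambda>x. rec_nat (f x) (\<lambda>m v. g x m v) (n x))"
proof -
  let ?g = "\<lambda>z. Some (g (pi1 z) (pi1 (pi2 z)) (pi2 (pi2 z)))"
  have aux: "prec_aux (\<lambda>x. Some (f x)) ?g a m = Some (rec_nat (f a) (\<lambda>m v. g a m v) m)" for a m
    by (induction m) simp_all
  have "total_recursive (\<lambda>z. rec_nat (f (pi1 z)) (\<lambda>m v. g (pi1 z) m v) (pi2 z))"
    using partial_recursive_in.prec[OF f[unfolded total_recursive_def partial_recursive_def]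
        g[unfolded total_recursive_def partial_recursive_def]]
    by (simp add: total_recursive_def partial_recursive_def prec_fun_def[abs_def] case_prod_beta aux)
  from total_recursive_comp[OF this total_recursive_pair[OF total_recursive_id n]]
  show ?thesis by simp
qed

lemma total_recursive_add [recursive_intros]:
  assumes "total_recursive f" "total_recursive g"
  shows "total_recursive (\<lambda>x. f x + g x)"
proof -
  have "rec_nat a (\<lambda>m v. Suc v) b = a + b" for a b :: nat
    by (induction b) simp_all
  moreover have "total_recursive (\<lambda>x. rec_nat (f x) (\<lambda>m v. Suc v) (g x))"
    by (intro recursive_intros assms)
  ultimately show ?thesis by simp
qed

lemma total_recursive_mult [recursive_intros]:
  assumes "total_recursive f" "total_recursive g"
  shows "total_recursive (\<lambda>x. f x * g x)"
proof -
  have "rec_nat 0 (\<lambda>m v. v + a) b = a * b" for a b :: nat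
    by (induction b) simp_all
  moreover have "total_recursive (\<lambda>x. rec_nat 0 (\<lambda>m v. v + f x) (g x))"
    by (intro recursive_intros total_recursive_comp[OF assms(1)] assms)
  ultimately show ?thesis by simp
qed

lemma total_recursive_power [recursive_intros]:
  assumes "total_recursive f" "total_recursive g"
  shows "total_recursive (\<lambda>x. f x ^ g x)"
proof -
  have "rec_nat 1 (\<lambda>m v. v * a) b = a ^ b" for a b :: nat
    by (induction b) simp_all
  moreover have "total_recursive (\<lambda>x. rec_nat 1 (\<lambda>m v. v * f x) (g x))"
    by (intro recursive_intros total_recursive_comp[OF assms(1)] assms)
  ultimately show ?thesis by simp
qed

lemma total_recursive_diff [recursive_intros]:
  assumes "total_recursive f" "total_recursive g"
  shows "total_recursive (\<lambda>x. f x - g x)"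
proof -
  have *: "rec_nat 0 (\<lambda>m v. m) b = b - 1" for b :: nat
    by (cases b) simp_all
  have "total_recursive (\<lambda>x. rec_nat 0 (\<lambda>m v. m) x)"
    by (intro recursive_intros)
  then have pred: "total_recursive (\<lambda>x. x - 1)"
    by (simp add: *)
  have "rec_nat a (\<lambda>m v. v - 1) b = a - b" for a b :: nat
    by (induction b) simp_all
  moreover have "total_recursive (\<lambda>x. rec_nat (f x) (\<lambda>m v. v - 1) (g x))"
    by (intro recursive_intros total_recursive_comp[OF pred] assms)
  ultimately show ?thesis by simp
qed

lemma total_recursive_if [recursive_intros]:
  assumes "decidable P" "total_recursive f" "total_recursive g"
  shows "total_recursive (\<lambda>x. if P x then f x else g x)"
proof -
  \<comment> \<open>Recursion along the indicator of P takes one step if P holds and none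
    otherwise.\<close>
  have "total_recursive (\<lambda>x. rec_nat (g x) (\<lambda>m v. f x) (if P x then 1 else 0))"
    by (intro recursive_intros total_recursive_comp[OF assms(2)] assms assms(1)[unfolded decidable_def])
  moreover have "rec_nat (g x) (\<lambda>m v. f x) (if P x then 1 else 0) = (if P x then f x else g x)" for x
    by simp
  ultimately show ?thesis by simp
qed

lemma decidable_comp:
  assumes "decidable P" "total_recursive f"
  shows "decidable (\<lambda>x. P (f x))"
  using total_recursive_comp[OF assms(1)[unfolded decidable_def] assms(2)]
  by (simp add: decidable_def)

lemma decidable_eq_0:
  assumes "total_recursive f"
  shows "decidable (\<lambda>x. f x = 0)"
proof -
  have "total_recursive (\<lambda>x. 1 - f x)"
    by (intro recursive_intros assms)
  moreover have "(\<lambda>x. 1 - f x) = (\<lambda>x. if f x = 0 then 1 else 0)"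
    by auto
  ultimately show ?thesis by (simp add: decidable_def)
qed

lemma decidable_not [recursive_intros]:
  assumes "decidable P"
  shows "decidable (\<lambda>x. \<not> P x)"
proof -
  have "((if P x then 1 else 0) = (0::nat)) = (\<not> P x)" for x
    by simp
  with decidable_eq_0[OF assms[unfolded decidable_def]] show ?thesis by simp
qed

lemma decidable_conj [recursive_intros]:
  assumes "decidable P" "decidable Q"
  shows "decidable (\<lambda>x. P x \<and> Q x)"
proof -
  have "total_recursive (\<lambda>x. if P x then if Q x then 1 else 0 else 0)"
    by (intro recursive_intros assms)
  moreover have "(if P x then if Q x then 1 else 0 else 0) = (if P x \<and> Q x then 1 else 0 :: nat)" for x
    by simp
  ultimately show ?thesis by (simp add: decidable_def)
qed

lemma decidable_disj [recursive_intros]: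
  assumes "decidable P" "decidable Q"
  shows "decidable (\<lambda>x. P x \<or> Q x)"
proof -
  have "decidable (\<lambda>x. \<not> (\<not> P x \<and> \<not> Q x))"
    by (intro recursive_intros assms)
  then show ?thesis by simp
qed

lemma decidable_imp [recursive_intros]:
  assumes "decidable P" "decidable Q"
  shows "decidable (\<lambda>x. P x \<longrightarrow> Q x)"
proof -
  have "decidable (\<lambda>x. \<not> P x \<or> Q x)"
    by (intro recursive_intros assms)
  then show ?thesis by (simp only: imp_conv_disj)
qed

lemma decidable_le [recursive_intros]:
  assumes "total_recursive f" "total_recursive g"
  shows "decidable (\<lambda>x. f x \<le> g x)"
  using decidable_eq_0[OF total_recursive_diff[OF assms]] by simp

lemma decidable_less [recursive_intros]:
  assumes "total_recursive f" "total_recursive g"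
  shows "decidable (\<lambda>x. f x < g x)"
  using decidable_not[OF decidable_le[OF assms(2,1)]] by (simp add: not_le)

lemma decidable_eq [recursive_intros]:
  fixes f g :: "nat \<Rightarrow> nat"
  assumes "total_recursive f" "total_recursive g"
  shows "decidable (\<lambda>x. f x = g x)"
proof -
  have "decidable (\<lambda>x. f x \<le> g x \<and> g x \<le> f x)"
    by (intro recursive_intros assms)
  then show ?thesis by (simp add: order_class.order_eq_iff)
qed

text \<open>Counting is the common source of the bounded quantifiers and of the test in
  \<open>big_rule\<close> that at least k children qualify.\<close>

lemma total_recursive_bounded_card [recursive_intros]:
  assumes P: "decidable (\<lambda>z. P (pi1 z) (pi2 z))" and g: "total_recursive g"
  shows "total_recursive (\<lambda>x. card {i. i < g x \<and> P x i})"
proof -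
  have card: "rec_nat 0 (\<lambda>m v. if P x m then Suc v else v) n = card {i. i < n \<and> P x i}" for x n
  proof (induction n)
    case (Suc n)
    have "{i. i < Suc n \<and> P x i} = (if P x n then insert n {i. i < n \<and> P x i} else {i. i < n \<and> P x i})"
      by (auto simp: less_Suc_eq)
    with Suc show ?case by simp
  qed simp
  have "decidable (\<lambda>z. P (pi1 z) (pi1 (pi2 z)))"
    using decidable_comp[OF P, of "\<lambda>z. pr (pi1 z) (pi1 (pi2 z))"]
    by (simp add: recursive_intros)
  then have "total_recursive (\<lambda>x. rec_nat 0 (\<lambda>m v. if P x m then Suc v else v) (g x))"
    by (intro recursive_intros g)
  then show ?thesis by (simp add: card)
qed

lemma decidable_bounded_ex [recursive_intros]:
  assumes P: "decidable (\<lambda>z. P (pi1 z) (pi2 z))" and g: "total_recursive g"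
  shows "decidable (\<lambda>x. \<exists>i<g x. P x i)"
proof -
  have "decidable (\<lambda>x. card {i. i < g x \<and> P x i} \<noteq> 0)"
    by (intro recursive_intros assms)
  moreover have "card {i. i < g x \<and> P x i} \<noteq> 0 \<longleftrightarrow> (\<exists>i<g x. P x i)" for x
    by (auto simp: card_eq_0_iff)
  ultimately show ?thesis by simp
qed

lemma decidable_bounded_all [recursive_intros]:
  assumes P: "decidable (\<lambda>z. P (pi1 z) (pi2 z))" and g: "total_recursive g"
  shows "decidable (\<lambda>x. \<forall>i<g x. P x i)"
proof -
  have "decidable (\<lambda>x. \<not> (\<exists>i<g x. \<not> P x i))"
    by (intro recursive_intros assms)
  then show ?thesis by simp
qed

text \<open>The test is total, so no undefined value can block the search of \<open>mu_fun\<close>,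
  and its first zero is the least witness. In the applications the witness also contains a
  certificate, and h extracts the output.\<close>

lemma partial_recursive_search:
  assumes P: "decidable (\<lambda>z. P (pi1 z) (pi2 z))" and h: "total_recursive h"
  shows "partial_recursive (\<lambda>x. if \<exists>y. P x y then Some (h (LEAST y. P x y)) else None)"
proof -
  let ?f = "\<lambda>z. Some (if P (pi1 z) (pi2 z) then 0 else 1)"
  have "total_recursive (\<lambda>z. if P (pi1 z) (pi2 z) then 0 else 1)"
    by (intro recursive_intros P)
  then have f: "partial_recursive_in {} ?f"
    by (simp add: total_recursive_def partial_recursive_def)
  have fz: "is_first_zero ?f x n \<longleftrightarrow> P x n \<and> (\<forall>m<n. \<not> P x m)" for x n
    by (auto simp: is_first_zero_def)
  have "mu_fun ?f x = (if \<exists>y. P x y then Some (LEAST y. P x y) else None)" for x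
  proof (cases "\<exists>y. P x y")
    case True
    have *: "is_first_zero ?f x n \<longleftrightarrow> n = (LEAST y. P x y)" for n
      unfolding fz using True
      by (metis LeastI Least_equality linorder_not_le not_less_Least)
    show ?thesis unfolding mu_fun_def * using True by simp
  qed (simp add: mu_fun_def fz)
  then have "mu_fun ?f = (\<lambda>x. if \<exists>y. P x y then Some (LEAST y. P x y) else None)"
    by blast
  then have "partial_recursive_in {} (\<lambda>x. if \<exists>y. P x y then Some (LEAST y. P x y) else None)"
    using partial_recursive_in.mu[OF f] by simp
  from partial_recursive_in.comp[OF h[unfolded total_recursive_def partial_recursive_def] this]
  have "partial_recursive_in {} (comp_fun (\<lambda>x. Some (h x))
      (\<lambda>x. if \<exists>y. P x y then Some (LEAST y. P x y) else None))" .
  moreover have "comp_fun (\<lambda>x. Some (h x)) (\<lambda>x. if \<exists>y. P x y then Some (LEAST y. P x y) else None)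
      = (\<lambda>x. if \<exists>y. P x y then Some (h (LEAST y. P x y)) else None)"
    by (rule ext) (simp add: comp_fun_def)
  ultimately show ?thesis by (simp add: partial_recursive_def)
qed

lemma total_recursive_Least:
  assumes P: "decidable (\<lambda>z. P (pi1 z) (pi2 z))" and ex: "\<And>x. \<exists>y. P x y"
  shows "total_recursive (\<lambda>x. LEAST y. P x y)"
  using partial_recursive_search[OF P total_recursive_id] ex by (simp add: total_recursive_def)

subsection \<open>Codes of lists\<close>

text \<open>\<open>list_encode\<close> codes a nonempty list as the successor of the pair of its
  head and the code of its tail, so \<open>pi2 (v - 1)\<close> is the code of the tail.\<close>

definition drop_code :: "nat \<Rightarrow> nat \<Rightarrow> nat" where
  "drop_code j c = rec_nat c (\<lambda>_ v. pi2 (v - 1)) j"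

abbreviation head_code :: "nat \<Rightarrow> nat" where "head_code c \<equiv> pi1 (c - 1)"

lemma list_decode_eq_Nil_iff [simp]: "list_decode c = [] \<longleftrightarrow> c = 0"
  by (metis list_decode.simps(1) list_decode_inverse list_encode.simps(1))

lemma list_decode_nonzero: "c \<noteq> 0 \<Longrightarrow> list_decode c = head_code c # list_decode (pi2 (c - 1))"
  by (cases c) (simp_all add: case_prod_beta)

lemma list_decode_drop_code: "list_decode (drop_code j c) = drop j (list_decode c)"
proof (induction j)
  case 0
  show ?case by (simp add: drop_code_def)
next
  case (Suc j)
  have "drop_code (Suc j) c = pi2 (drop_code j c - 1)"
    by (simp add: drop_code_def)
  \<comment> \<open>Past the end of the list the code stays at 0, the code of the empty
    list.\<close>
  moreover have "pi2 (0 - 1) = 0"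
    using le_prod_encode_2[of "pi2 0" "pi1 0"] by simp
  ultimately have "list_decode (drop_code (Suc j) c) = tl (list_decode (drop_code j c))"
    by (cases "drop_code j c = 0") (simp_all add: list_decode_nonzero)
  also have "\<dots> = drop (Suc j) (list_decode c)"
    by (simp add: Suc.IH drop_Suc tl_drop)
  finally show ?case .
qed

lemma length_list_decode_le: "length (list_decode c) \<le> c"
proof (induction c rule: list_decode.induct)
  case (2 c)
  obtain a b where ab: "prod_decode c = (a, b)" by fastforce
  then have "c = pr a b" by (metis prod_decode_inverse)
  then have "b \<le> c" using le_prod_encode_2 by simp
  with 2[of a b] ab show ?case by simp
qed simp

lemma drop_code_nonzero_iff: "drop_code j c \<noteq> 0 \<longleftrightarrow> j < length (list_decode c)"
  by (metis list_decode_drop_code list_decode_eq_Nil_iff drop_eq_Nil not_le)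

lemma drop_code_nonzero_imp_less: "drop_code j c \<noteq> 0 \<Longrightarrow> j < c"
  unfolding drop_code_nonzero_iff using length_list_decode_le[of c] by simp

lemma nth_list_decode:
  assumes "j < length (list_decode c)"
  shows "list_decode c ! j = head_code (drop_code j c)"
    and "drop (Suc j) (list_decode c) = list_decode (pi2 (drop_code j c - 1))"
proof -
  have "drop j (list_decode c) = head_code (drop_code j c) # list_decode (pi2 (drop_code j c - 1))"
    using list_decode_nonzero[of "drop_code j c"] assms
    by (simp only: drop_code_nonzero_iff list_decode_drop_code)
  with Cons_nth_drop_Suc[OF assms] show "list_decode c ! j = head_code (drop_code j c)"
    and "drop (Suc j) (list_decode c) = list_decode (pi2 (drop_code j c - 1))"
    by simp_all
qed

lemma total_recursive_drop_code [recursive_intros]: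
  assumes "total_recursive f" "total_recursive g"
  shows "total_recursive (\<lambda>x. drop_code (f x) (g x))"
  unfolding drop_code_def by (intro recursive_intros assms)

lemma total_recursive_length [recursive_intros]:
  assumes "total_recursive f"
  shows "total_recursive (\<lambda>x. length (list_decode (f x)))"
proof -
  have "{j. j < c \<and> drop_code j c \<noteq> 0} = {..<length (list_decode c)}" for c
    using drop_code_nonzero_imp_less drop_code_nonzero_iff by auto
  then have eq: "card {j. j < c \<and> drop_code j c \<noteq> 0} = length (list_decode c)" for c
    by simp
  have "total_recursive (\<lambda>x. card {j. j < f x \<and> drop_code j (f x) \<noteq> 0})"
    by (intro recursive_intros total_recursive_comp[OF assms] assms)
  then show ?thesis by (simp only: eq)
qed

lemma decidable_Bex_list [recursive_intros]:
  assumes P: "decidable (\<lambda>z. P (pi1 z) (pi2 z))" and f: "total_recursive f"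
  shows "decidable (\<lambda>x. \<exists>d\<in>set (list_decode (f x)). P x d)"
proof -
  \<comment> \<open>Positions in a list are bounded by its code, so quantifying over the entries is
    bounded quantification.\<close>
  have eq: "(\<exists>d\<in>set (list_decode c). Q d) \<longleftrightarrow>
      (\<exists>j<c. drop_code j c \<noteq> 0 \<and> Q (head_code (drop_code j c)))" for Q c
    by (metis in_set_conv_nth nth_list_decode(1) drop_code_nonzero_iff drop_code_nonzero_imp_less)
  have *: "decidable (\<lambda>z. P (pi1 z) (head_code (drop_code (pi2 z) (f (pi1 z)))))"
    using decidable_comp[OF P, of "\<lambda>z. pr (pi1 z) (head_code (drop_code (pi2 z) (f (pi1 z))))"]
    by (simp add: recursive_intros total_recursive_comp[OF f])
  show ?thesis
    unfolding eq by (intro recursive_intros * total_recursive_comp[OF f] f)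
qed

lemma decidable_mem_list [recursive_intros]:
  assumes "total_recursive f" "total_recursive g"
  shows "decidable (\<lambda>x. f x \<in> set (list_decode (g x)))"
proof -
  have "decidable (\<lambda>x. \<exists>d\<in>set (list_decode (g x)). f x = d)"
    by (intro recursive_intros total_recursive_comp[OF assms(1)] assms)
  then show ?thesis by simp
qed

subsection \<open>Finite derivations\<close>

text \<open>The rule \<open>J n D\<close> reads: n follows from the premises D. A derivation has its
  last conclusion in front and the premises behind it. Being a finite list it has a code, so for a
  decidable rule derivability can be confirmed by unbounded search.\<close>

primrec valid :: "(nat \<Rightarrow> nat set \<Rightarrow> bool) \<Rightarrow> nat list \<Rightarrow> bool" where
  "valid J [] \<longleftrightarrow> True"
| "valid J (n # L) \<longleftrightarrow> J n (set L) \<and> valid J L"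

definition derivable :: "(nat \<Rightarrow> nat set \<Rightarrow> bool) \<Rightarrow> nat set" where
  "derivable J = {n. \<exists>L. valid J L \<and> n \<in> set L}"

definition mono_rule :: "(nat \<Rightarrow> nat set \<Rightarrow> bool) \<Rightarrow> bool" where
  "mono_rule J \<longleftrightarrow> (\<forall>n D D'. J n D \<longrightarrow> D \<subseteq> D' \<longrightarrow> J n D')"

definition finitary_rule :: "(nat \<Rightarrow> nat set \<Rightarrow> bool) \<Rightarrow> bool" where
  "finitary_rule J \<longleftrightarrow> (\<forall>n D. J n D \<longrightarrow> (\<exists>F\<subseteq>D. finite F \<and> J n F))"

lemma valid_nth: "valid J L \<longleftrightarrow> (\<forall>j<length L. J (L ! j) (set (drop (Suc j) L)))"
proof (induction L)
  case (Cons n L)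
  then show ?case by (auto simp: All_less_Suc2)
qed simp

lemma decidable_valid [recursive_intros]:
  assumes J: "decidable (\<lambda>z. J (pi1 z) (pi1 (pi2 z)) (set (list_decode (pi2 (pi2 z)))))"
    and f: "total_recursive f"
  shows "decidable (\<lambda>x. valid (J x) (list_decode (f x)))"
proof -
  have eq: "valid I (list_decode c) \<longleftrightarrow> (\<forall>j<c. drop_code j c \<noteq> 0 \<longrightarrow>
      I (head_code (drop_code j c)) (set (list_decode (pi2 (drop_code j c - 1)))))" for I c
    unfolding valid_nth
    by (metis nth_list_decode drop_code_nonzero_iff drop_code_nonzero_imp_less)
  have *: "decidable (\<lambda>z. J (pi1 z) (head_code (drop_code (pi2 z) (f (pi1 z))))
      (set (list_decode (pi2 (drop_code (pi2 z) (f (pi1 z)) - 1)))))"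
    using decidable_comp[OF J, of "\<lambda>z. pr (pi1 z) (pr (head_code (drop_code (pi2 z) (f (pi1 z))))
      (pi2 (drop_code (pi2 z) (f (pi1 z)) - 1)))"]
    by (simp add: recursive_intros total_recursive_comp[OF f])
  show ?thesis
    unfolding eq by (intro recursive_intros * total_recursive_comp[OF f] f)
qed

lemma valid_mono:
  assumes "\<And>n D. J n D \<Longrightarrow> J' n D" "valid J L"
  shows "valid J' L"
  using assms(2) by (induction L) (auto intro: assms(1))

lemma valid_append:
  assumes "mono_rule J" "valid J L" "valid J L'"
  shows "valid J (L @ L')"
  using assms(2) by (induction L) (use assms(1,3) in \<open>auto simp: mono_rule_def\<close>)

lemma finite_derivable:
  assumes "mono_rule J" "finite F" "F \<subseteq> derivable J"
  shows "\<exists>L. valid J L \<and> F \<subseteq> set L"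
  using assms(2,3)
proof (induction F)
  case empty
  show ?case by (rule exI[of _ "[]"]) simp
next
  case (insert n F)
  then obtain L L' where "valid J L" "F \<subseteq> set L" "valid J L'" "n \<in> set L'"
    by (auto simp: derivable_def)
  then show ?case
    by (intro exI[of _ "L @ L'"]) (auto intro: valid_append assms)
qed

text \<open>Finitely many premises suffice, and their derivations concatenate to one list, in front
  of which n may be placed.\<close>

lemma derivable_closed:
  assumes "mono_rule J" "finitary_rule J" "J n (derivable J)"
  shows "n \<in> derivable J"
proof -
  obtain F where F: "F \<subseteq> derivable J" "finite F" "J n F"
    using assms unfolding finitary_rule_def by blast
  then obtain L where "valid J L" "F \<subseteq> set L"
    using finite_derivable assms(1) by blast
  then have "valid J (n # L)"
    using F assms(1) unfolding mono_rule_def by auto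
  then show ?thesis unfolding derivable_def by (auto intro!: exI[of _ "n # L"])
qed

lemma valid_induct:
  assumes "valid J L" "\<And>n D. J n D \<Longrightarrow> D \<subseteq> S \<Longrightarrow> n \<in> S"
  shows "set L \<subseteq> S"
  using assms(1) by (induction L) (auto intro: assms(2))

lemma derivable_iff:
  assumes "mono_rule J" "finitary_rule J"
  shows "n \<in> derivable J \<longleftrightarrow> J n (derivable J)"
proof
  assume "n \<in> derivable J"
  moreover have "valid J L \<Longrightarrow> set L \<subseteq> {n. J n (derivable J)}" for L
  proof (induction L)
    case (Cons n L)
    then have "set L \<subseteq> derivable J" by (auto simp: derivable_def)
    with Cons assms(1) show ?case unfolding mono_rule_def by auto
  qed simp
  ultimately show "J n (derivable J)" by (auto simp: derivable_def)
qed (rule derivable_closed[OF assms])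

subsection \<open>A universal partial recursive function\<close>

abbreviation tri :: "nat \<Rightarrow> nat \<Rightarrow> nat \<Rightarrow> nat" where "tri e x v \<equiv> pr e (pr x v)"

abbreviation outcome :: "nat \<Rightarrow> nat" where "outcome d \<equiv> pi2 (pi2 d)"

text \<open>The tags 0 to 8 stand for the constructors of \<open>partial_recursive_in\<close>, an
  index is \<open>pr t (pr f g)\<close>, and \<open>tri e x v\<close> is the claim that index e
  outputs v on input x. The oracle is a relation, so that a finite string can serve as a partial
  oracle. Intermediate values are read off members of D instead of being quantified over all
  numbers, which keeps the clause decidable for finite D.\<close>

definition eval_clause :: "(nat \<Rightarrow> nat \<Rightarrow> bool) \<Rightarrow> nat \<Rightarrow> nat \<Rightarrow> nat \<Rightarrow> nat \<Rightarrow> nat \<Rightarrow> nat \<Rightarrow> nat set \<Rightarrow> bool" where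
  "eval_clause Or t f g e x v D \<longleftrightarrow>
     t = 0 \<and> v = 0
   \<or> t = 1 \<and> v = Suc x
   \<or> t = 2 \<and> v = pi1 x
   \<or> t = 3 \<and> v = pi2 x
   \<or> t = 4 \<and> Or x v
   \<or> t = 5 \<and> tri f x (pi1 v) \<in> D \<and> tri g x (pi2 v) \<in> D
   \<or> t = 6 \<and> (\<exists>d\<in>D. d = tri g x (outcome d) \<and> tri f (outcome d) v \<in> D)
   \<or> t = 7 \<and> pi2 x = 0 \<and> tri f (pi1 x) v \<in> D
   \<or> t = 7 \<and> pi2 x \<noteq> 0 \<and> (\<exists>d\<in>D. d = tri e (pr (pi1 x) (pi2 x - 1)) (outcome d) \<and>
        tri g (pr (pi1 x) (pr (pi2 x - 1) (outcome d))) v \<in> D)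
   \<or> t = 8 \<and> tri f (pr x v) 0 \<in> D \<and> (\<forall>m<v. \<exists>d\<in>D. d = tri f (pr x m) (outcome d) \<and> outcome d \<noteq> 0)"

definition eval_rule :: "(nat \<Rightarrow> nat \<Rightarrow> bool) \<Rightarrow> nat \<Rightarrow> nat set \<Rightarrow> bool" where
  "eval_rule Or u = eval_clause Or (pi1 (pi1 u)) (pi1 (pi2 (pi1 u))) (pi2 (pi2 (pi1 u)))
     (pi1 u) (pi1 (pi2 u)) (pi2 (pi2 u))"

lemma eval_clause_mono:
  assumes "eval_clause Or t f g e x v D" "D \<subseteq> D'" "\<And>v. Or x v \<Longrightarrow> Or' x v"
  shows "eval_clause Or' t f g e x v D'"
  using assms(1) unfolding eval_clause_def
  by (elim disjE conjE;
      simp add: subsetD[OF assms(2)] assms(3); blast dest: subsetD[OF assms(2)])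

text \<open>The oracle is compared only at the argument of the claim u itself;
  \<open>eval_graph_prefix\<close> relies on this to bound the part of the oracle that a derivation
  consults.\<close>

lemma eval_rule_mono:
  assumes "eval_rule Or u D" "D \<subseteq> D'" "\<And>v. Or (pi1 (pi2 u)) v \<Longrightarrow> Or' (pi1 (pi2 u)) v"
  shows "eval_rule Or' u D'"
  using assms unfolding eval_rule_def by (rule eval_clause_mono)

lemma mono_eval_rule: "mono_rule (eval_rule Or)"
  unfolding mono_rule_def by (blast intro: eval_rule_mono)

text \<open>Only minimization has a number of premises that depends on v; every other clause uses at
  most two.\<close>

lemma eval_clause_finitary:
  assumes "eval_clause Or t f g e x v D"
  shows "\<exists>F\<subseteq>D. finite F \<and> eval_clause Or t f g e x v F"
proof (cases "t = 8")
  case True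
  then have D: "tri f (pr x v) 0 \<in> D" "\<forall>m<v. \<exists>d. d \<in> D \<and> d = tri f (pr x m) (outcome d) \<and> outcome d \<noteq> 0"
    using assms by (auto simp: eval_clause_def)
  then obtain h where h: "\<And>m. m < v \<Longrightarrow> h m \<in> D \<and> h m = tri f (pr x m) (outcome (h m)) \<and> outcome (h m) \<noteq> 0"
    by metis
  let ?F = "insert (tri f (pr x v) 0) (h ` {..<v})"
  have "?F \<subseteq> D" "finite ?F" using D h by auto
  moreover have "\<exists>d\<in>?F. d = tri f (pr x m) (outcome d) \<and> outcome d \<noteq> 0" if "m < v" for m
    using h[OF that] that by (intro bexI[of _ "h m"]) auto
  then have "eval_clause Or t f g e x v ?F"
    unfolding eval_clause_def using True by blast
  ultimately show ?thesis by blast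
next
  case False
  consider "eval_clause Or t f g e x v {}" | "t = 5" | "t = 6" | "t = 7" "pi2 x = 0" | "t = 7" "pi2 x \<noteq> 0"
    using assms False unfolding eval_clause_def by (elim disjE conjE) simp_all
  then show ?thesis
  proof cases
    case 1
    then show ?thesis by blast
  next
    case 2
    then show ?thesis using assms
      by (intro exI[of _ "{tri f x (pi1 v), tri g x (pi2 v)}"]) (simp add: eval_clause_def)
  next
    case 3
    then obtain d where "d \<in> D" "d = tri g x (outcome d)" "tri f (outcome d) v \<in> D"
      using assms by (auto simp: eval_clause_def)
    then show ?thesis using 3
      by (intro exI[of _ "{d, tri f (outcome d) v}"]) (simp add: eval_clause_def)
  next
    case 4
    then show ?thesis using assms
      by (intro exI[of _ "{tri f (pi1 x) v}"]) (simp add: eval_clause_def)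
  next
    case 5
    then obtain d where "d \<in> D" "d = tri e (pr (pi1 x) (pi2 x - 1)) (outcome d)"
        "tri g (pr (pi1 x) (pr (pi2 x - 1) (outcome d))) v \<in> D"
      using assms by (auto simp: eval_clause_def)
    then show ?thesis using 5
      by (intro exI[of _ "{d, tri g (pr (pi1 x) (pr (pi2 x - 1) (outcome d))) v}"])
        (simp add: eval_clause_def)
  qed
qed

lemma finitary_eval_rule: "finitary_rule (eval_rule Or)"
  unfolding finitary_rule_def eval_rule_def by (blast intro: eval_clause_finitary)

definition eval_graph :: "(nat \<Rightarrow> nat \<Rightarrow> bool) \<Rightarrow> nat \<Rightarrow> nat \<Rightarrow> nat \<Rightarrow> bool" where
  "eval_graph Or e x v \<longleftrightarrow> tri e x v \<in> derivable (eval_rule Or)"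

lemma eval_graph_iff:
  "eval_graph Or (pr t (pr f g)) x v \<longleftrightarrow>
     t = 0 \<and> v = 0
   \<or> t = 1 \<and> v = Suc x
   \<or> t = 2 \<and> v = pi1 x
   \<or> t = 3 \<and> v = pi2 x
   \<or> t = 4 \<and> Or x v
   \<or> t = 5 \<and> eval_graph Or f x (pi1 v) \<and> eval_graph Or g x (pi2 v)
   \<or> t = 6 \<and> (\<exists>w. eval_graph Or g x w \<and> eval_graph Or f w v)
   \<or> t = 7 \<and> pi2 x = 0 \<and> eval_graph Or f (pi1 x) v
   \<or> t = 7 \<and> pi2 x \<noteq> 0 \<and> (\<exists>w. eval_graph Or (pr t (pr f g)) (pr (pi1 x) (pi2 x - 1)) w \<and>
        eval_graph Or g (pr (pi1 x) (pr (pi2 x - 1) w)) v)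
   \<or> t = 8 \<and> eval_graph Or f (pr x v) 0 \<and> (\<forall>m<v. \<exists>w. eval_graph Or f (pr x m) w \<and> w \<noteq> 0)"
proof -
  have ex: "(\<exists>d\<in>D. d = tri e x (outcome d) \<and> P (outcome d)) \<longleftrightarrow> (\<exists>w. tri e x w \<in> D \<and> P w)" for D e x P
    by (metis fst_conv snd_conv prod_encode_inverse)
  show ?thesis
    unfolding eval_graph_def
    by (subst derivable_iff[OF mono_eval_rule finitary_eval_rule])
      (simp only: eval_rule_def eval_clause_def prod_encode_inverse fst_conv snd_conv
        ex[where P = "\<lambda>w. tri f w v \<in> derivable (eval_rule Or)"] ex[where P = "\<lambda>w. w \<noteq> 0"]
        ex[where P = "\<lambda>w. tri g (tri (pi1 x) (pi2 x - 1) w) v \<in> derivable (eval_rule Or)"])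
qed

text \<open>An enumeration theorem: each constructor contributes an index with its own tag. The
  relation has to be the graph of every oracle in B, so B has at most one element; the uses are the
  empty set and a singleton.\<close>

lemma partial_recursive_in_eval_graph:
  assumes "partial_recursive_in B f" and "\<And>Y x v. Y \<in> B \<Longrightarrow> Or x v \<longleftrightarrow> Y x = v"
  shows "\<exists>e. \<forall>x v. f x = Some v \<longleftrightarrow> eval_graph Or e x v"
  using assms(1)
proof induction
  case zero
  show ?case by (rule exI[of _ "pr 0 (pr 0 0)"]) (subst eval_graph_iff, auto)
next
  case succ
  show ?case by (rule exI[of _ "pr 1 (pr 0 0)"]) (subst eval_graph_iff, auto)
next
  case left
  show ?case by (rule exI[of _ "pr 2 (pr 0 0)"]) (subst eval_graph_iff, auto)
next
  case right
  show ?case by (rule exI[of _ "pr 3 (pr 0 0)"]) (subst eval_graph_iff, auto)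
next
  case (oracle_call Y)
  then show ?case by (intro exI[of _ "pr 4 (pr 0 0)"]) (subst eval_graph_iff, auto simp: assms(2))
next
  case (pair f g)
  then obtain d e where "\<forall>x v. f x = Some v \<longleftrightarrow> eval_graph Or d x v" "\<forall>x v. g x = Some v \<longleftrightarrow> eval_graph Or e x v"
    by blast
  moreover have "pair_fun f g x = Some v \<longleftrightarrow> f x = Some (pi1 v) \<and> g x = Some (pi2 v)" for x v
    by (auto simp: pair_fun_def Option.bind_eq_Some_conv)
  ultimately show ?case
    by (intro exI[of _ "pr 5 (pr d e)"]) (subst eval_graph_iff, simp)
next
  case (comp f g)
  then obtain d e where "\<forall>x v. f x = Some v \<longleftrightarrow> eval_graph Or d x v" "\<forall>x v. g x = Some v \<longleftrightarrow> eval_graph Or e x v"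
    by blast
  moreover have "comp_fun f g x = Some v \<longleftrightarrow> (\<exists>w. g x = Some w \<and> f w = Some v)" for x v
    by (auto simp: comp_fun_def Option.bind_eq_Some_conv)
  ultimately show ?case
    by (intro exI[of _ "pr 6 (pr d e)"]) (subst eval_graph_iff, simp)
next
  case (prec f g)
  then obtain d e where f: "\<forall>x v. f x = Some v \<longleftrightarrow> eval_graph Or d x v" and g: "\<forall>x v. g x = Some v \<longleftrightarrow> eval_graph Or e x v"
    by blast
  let ?e = "pr 7 (pr d e)"
  have *: "prec_aux f g a n = Some v \<longleftrightarrow> eval_graph Or ?e (pr a n) v" for a n v
  proof (induction n arbitrary: v)
    case 0
    show ?case by (subst eval_graph_iff) (simp add: f)
  next
    case (Suc n)
    show ?case
      by (subst eval_graph_iff) (simp add: Option.bind_eq_Some_conv Suc.IH g)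
  qed
  show ?case
  proof (intro exI[of _ ?e] allI)
    fix x v
    show "prec_fun f g x = Some v \<longleftrightarrow> eval_graph Or ?e x v"
      using *[of "pi1 x" "pi2 x" v] by (simp add: prec_fun_def case_prod_beta)
  qed
next
  case (mu f)
  then obtain d where f: "\<forall>x v. f x = Some v \<longleftrightarrow> eval_graph Or d x v"
    by blast
  have unique: "m = n" if "is_first_zero f x n" "is_first_zero f x m" for x m n
    using that unfolding is_first_zero_def
    by (metis linorder_neqE_nat nat.distinct(1) option.inject)
  have "mu_fun f x = Some v \<longleftrightarrow> is_first_zero f x v" for x v
    unfolding mu_fun_def by (metis option.distinct(1) option.inject theI' unique)
  moreover have "is_first_zero f x v \<longleftrightarrow>
      f (pr x v) = Some 0 \<and> (\<forall>m<v. \<exists>w. f (pr x m) = Some w \<and> w \<noteq> 0)" for x v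
    unfolding is_first_zero_def by (metis nat.distinct(1) not0_implies_Suc)
  ultimately show ?case
    by (intro exI[of _ "pr 8 (pr d 0)"]) (subst eval_graph_iff, simp add: f)
qed

text \<open>Strings are stored in reverse, so that appending an entry is \<^const>\<open>Cons\<close>.\<close>

definition string_oracle :: "nat list \<Rightarrow> nat \<Rightarrow> nat \<Rightarrow> bool" where
  "string_oracle \<sigma> j v \<longleftrightarrow> j < length \<sigma> \<and> rev \<sigma> ! j = v"

lemma decidable_string_oracle [recursive_intros]:
  assumes "total_recursive f" "total_recursive g" "total_recursive h"
  shows "decidable (\<lambda>x. string_oracle (list_decode (f x)) (g x) (h x))"
proof -
  have eq: "string_oracle (list_decode c) j v \<longleftrightarrow> j < length (list_decode c) \<and>
      head_code (drop_code (length (list_decode c) - Suc j) c) = v" for c j v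
    by (auto simp: string_oracle_def rev_nth nth_list_decode)
  show ?thesis
    unfolding eq by (intro recursive_intros assms)
qed

lemma decidable_valid_eval_rule [recursive_intros]:
  assumes "total_recursive f" "total_recursive g"
  shows "decidable (\<lambda>x. valid (eval_rule (string_oracle (list_decode (f x)))) (list_decode (g x)))"
  unfolding eval_rule_def eval_clause_def
  by (intro recursive_intros total_recursive_comp[OF assms(1)] assms)

lemma two_power_odd_inj:
  fixes d e x y :: nat
  assumes "2 ^ d * (2 * x + 1) = 2 ^ e * (2 * y + 1)"
  shows "d = e \<and> x = y"
  using assms
proof (induction d arbitrary: e)
  case 0
  then show ?case by (cases e) (auto, presburger)
next
  case (Suc d)
  show ?case
  proof (cases e)
    case 0
    with Suc.prems have "even (2 * y + 1)" by (metis dvd_mult2 dvd_triv_left mult_1 power_0 power_Suc)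
    then show ?thesis by simp
  next
    case (Suc e')
    with Suc.prems Suc.IH[of e'] show ?thesis by simp
  qed
qed

text \<open>On \<open>2 ^ e * (2 * x + 1)\<close> the function searches for a derivation that index
  e halts on x, with the empty string as oracle. Index and argument are recovered by unique
  factorization, and for fixed e the input is affine in x.\<close>

lemma ex_linearly_universal: "\<exists>\<psi>. linearly_universal \<psi>"
proof -
  define P where "P y w \<longleftrightarrow>
    valid (eval_rule (string_oracle (list_decode 0))) (list_decode (pi2 w)) \<and>
    pi1 w \<in> set (list_decode (pi2 w)) \<and>
    y = 2 ^ pi1 (pi1 w) * (2 * pi1 (pi2 (pi1 w)) + 1)" for y w
  define \<psi> where "\<psi> y = (if \<exists>w. P y w then Some (outcome (pi1 (LEAST w. P y w))) else None)" for y
  have "partial_recursive \<psi>"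
    unfolding \<psi>_def[abs_def] P_def
    by (intro partial_recursive_search recursive_intros)
  moreover have "\<exists>a b. \<forall>x. \<psi> (a * x + b) = \<theta> x" if \<theta>: "partial_recursive \<theta>" for \<theta>
  proof -
    let ?O = "string_oracle (list_decode 0)"
    obtain e where e: "\<forall>x v. \<theta> x = Some v \<longleftrightarrow> eval_graph ?O e x v"
      using partial_recursive_in_eval_graph[OF \<theta>[unfolded partial_recursive_def]] by blast
    have "\<psi> (2 ^ e * (2 * x + 1)) = \<theta> x" for x
    proof -
      let ?y = "2 ^ e * (2 * x + 1)"
      \<comment> \<open>Every witness gives the correct output, so it is harmless that the least one
        is taken.\<close>
      have sound: "\<theta> x = Some (outcome (pi1 w))" if "P ?y w" for w
      proof -
        have "pi1 (pi1 w) = e \<and> pi1 (pi2 (pi1 w)) = x"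
          using that two_power_odd_inj unfolding P_def by metis
        then have "pi1 w = tri e x (outcome (pi1 w))"
          by (metis prod.collapse prod_decode_inverse)
        then have "eval_graph ?O e x (outcome (pi1 w))"
          using that unfolding P_def eval_graph_def derivable_def by auto
        then show ?thesis using e by blast
      qed
      show ?thesis
      proof (cases "\<exists>w. P ?y w")
        case True
        then show ?thesis using sound[OF LeastI_ex[OF True]] by (simp add: \<psi>_def)
      next
        case False
        have "\<theta> x \<noteq> Some v" for v
        proof
          assume "\<theta> x = Some v"
          then have "eval_graph ?O e x v" using e by blast
          then obtain L where "valid (eval_rule ?O) L" "tri e x v \<in> set L"
            unfolding eval_graph_def derivable_def by blast
          then have "P ?y (pr (tri e x v) (list_encode L))"
            by (simp add: P_def)
          then show False using False by blast
        qed
        then have "\<theta> x = None" by (cases "\<theta> x") auto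
        then show ?thesis using False by (simp add: \<psi>_def)
      qed
    qed
    moreover have "2 * 2 ^ e * x + 2 ^ e = 2 ^ e * (2 * x + 1)" for x :: nat
      by (simp add: algebra_simps)
    ultimately show ?thesis
      by (intro exI[of _ "2 * 2 ^ e"] exI[of _ "2 ^ e"] allI) metis
  qed
  ultimately show ?thesis
    unfolding linearly_universal_def by blast
qed

subsection \<open>Bushy trees\<close>

text \<open>Existence of a finite k-bushy tree above the string with all its leaves in A. The tree
  is not an object of its own; it is the derivation of this predicate.\<close>

inductive big :: "(nat \<Rightarrow> nat) \<Rightarrow> nat \<Rightarrow> nat list set \<Rightarrow> nat list \<Rightarrow> bool" for q k A where
  leaf: "\<sigma> \<in> A \<Longrightarrow> big q k A \<sigma>"
| node: "S \<subseteq> {..<q (length \<sigma>)} \<Longrightarrow> k \<le> card S \<Longrightarrow> (\<And>i. i \<in> S \<Longrightarrow> big q k A (i # \<sigma>)) \<Longrightarrow> big q k A \<sigma>"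

text \<open>Pigeonhole at every node: each child in S is big for A or big for B, so among k + l
  children there are k of the first kind or l of the second.\<close>

lemma big_Un:
  assumes "big q (k + l) (A \<union> B) \<sigma>"
  shows "big q k A \<sigma> \<or> big q l B \<sigma>"
  using assms
proof induction
  case (leaf \<sigma>)
  then show ?case using big.leaf[of \<sigma> A] big.leaf[of \<sigma> B] by auto
next
  case (node S \<sigma>)
  let ?SA = "{i\<in>S. big q k A (i # \<sigma>)}" and ?SB = "{i\<in>S. big q l B (i # \<sigma>)}"
  have "S = ?SA \<union> ?SB" using node.IH by auto
  then have "card S \<le> card ?SA + card ?SB" using card_Un_le[of ?SA ?SB] by simp
  with node.hyps(2) have "k \<le> card ?SA \<or> l \<le> card ?SB" by linarith
  then show ?case
  proof
    assume "k \<le> card ?SA"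
    with node.hyps(1) have "big q k A \<sigma>" by - (rule big.node[of ?SA], auto)
    then show ?thesis ..
  next
    assume "l \<le> card ?SB"
    with node.hyps(1) have "big q l B \<sigma>" by - (rule big.node[of ?SB], auto)
    then show ?thesis ..
  qed
qed

text \<open>Smallness is subadditive by \<open>big_Un\<close>: each set A v adds k to the
  bushiness.\<close>

lemma not_big_UN:
  assumes "\<not> big q l B \<sigma>" "\<And>v. v < M \<Longrightarrow> \<not> big q k (A v) \<sigma>"
  shows "\<not> big q (l + M * k) (B \<union> (\<Union>v<M. A v)) \<sigma>"
  using assms(2)
proof (induction M)
  case 0
  then show ?case using assms(1) by simp
next
  case (Suc M)
  then have "\<not> big q (l + M * k + k) ((B \<union> (\<Union>v<M. A v)) \<union> A M) \<sigma>"
    using big_Un by (metis less_Suc_eq)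
  moreover have "l + Suc M * k = l + M * k + k" by simp
  moreover have "B \<union> (\<Union>v<Suc M. A v) = (B \<union> (\<Union>v<M. A v)) \<union> A M"
    by (auto simp: lessThan_Suc)
  ultimately show ?case by metis
qed

definition bounded_string :: "(nat \<Rightarrow> nat) \<Rightarrow> nat list \<Rightarrow> bool" where
  "bounded_string q \<sigma> \<longleftrightarrow> (\<forall>j<length \<sigma>. rev \<sigma> ! j < q j)"

lemma bounded_string_Nil [simp]: "bounded_string q []"
  by (simp add: bounded_string_def)

lemma bounded_string_Cons [simp]:
  "bounded_string q (i # \<sigma>) \<longleftrightarrow> bounded_string q \<sigma> \<and> i < q (length \<sigma>)"
  by (auto simp: bounded_string_def nth_append less_Suc_eq)

text \<open>If all children of a string were big, so would be the string, because monotonicity of q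
  gives it at least k children. Hence some next entry preserves smallness.\<close>

lemma not_big_extend:
  assumes "mono q" "k \<le> q (length \<sigma>)" "\<not> big q k B \<sigma>" "bounded_string q \<sigma>"
  shows "\<exists>\<rho>. length \<rho> = n \<and> bounded_string q (\<rho> @ \<sigma>) \<and> \<not> big q k B (\<rho> @ \<sigma>)"
proof (induction n)
  case 0
  show ?case using assms by simp
next
  case (Suc n)
  then obtain \<rho> where \<rho>: "length \<rho> = n" "bounded_string q (\<rho> @ \<sigma>)" "\<not> big q k B (\<rho> @ \<sigma>)"
    by blast
  have "k \<le> q (length (\<rho> @ \<sigma>))"
    using assms(1,2) by (metis length_append le_add2 le_trans monoD)
  with \<rho>(3) obtain i where "i < q (length (\<rho> @ \<sigma>))" "\<not> big q k B (i # \<rho> @ \<sigma>)"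
    using big.node[of "{..<q (length (\<rho> @ \<sigma>))}"] by (metis card_lessThan lessThan_iff subset_refl)
  with \<rho> show ?case by (intro exI[of _ "i # \<rho>"]) simp
qed

text \<open>Descend in the tree for A: at each node some child in S is not big for B, as otherwise
  the node would be. The descent ends in a leaf.\<close>

lemma big_not_big_leaf:
  assumes "big q k A \<sigma>" "\<not> big q k B \<sigma>" "bounded_string q \<sigma>"
  shows "\<exists>\<rho>. \<rho> @ \<sigma> \<in> A \<and> bounded_string q (\<rho> @ \<sigma>) \<and> \<not> big q k B (\<rho> @ \<sigma>)"
  using assms
proof induction
  case (leaf \<sigma>)
  then show ?case by (intro exI[of _ "[]"]) simp
next
  case (node S \<sigma>)
  then obtain i where i: "i \<in> S" "\<not> big q k B (i # \<sigma>)"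
    using big.node[of S q \<sigma> k B] by blast
  with node have "bounded_string q (i # \<sigma>)" by auto
  with node.IH i obtain \<rho> where "\<rho> @ i # \<sigma> \<in> A" "bounded_string q (\<rho> @ i # \<sigma>)"
      "\<not> big q k B (\<rho> @ i # \<sigma>)"
    by blast
  then show ?case by (intro exI[of _ "\<rho> @ [i]"]) simp
qed

section \<open>Effective search for bushy trees\<close>

definition eval_set :: "nat \<Rightarrow> nat \<Rightarrow> nat \<Rightarrow> nat list set" where
  "eval_set e m v = {\<sigma>. eval_graph (string_oracle \<sigma>) e m v}"

text \<open>A derivation remains valid when the oracle answers more queries, so longer strings force
  at least as many values.\<close>

lemma eval_graph_mono:
  assumes "\<And>x v. Or x v \<Longrightarrow> Or' x v" "eval_graph Or e m v"
  shows "eval_graph Or' e m v"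
proof -
  have "eval_rule Or n D \<Longrightarrow> eval_rule Or' n D" for n D
    by (erule eval_rule_mono[OF _ subset_refl]) (rule assms(1))
  then show ?thesis
    using assms(2) unfolding eval_graph_def derivable_def by (blast intro: valid_mono)
qed

lemma eval_set_append: "\<sigma> \<in> eval_set e m v \<Longrightarrow> \<rho> @ \<sigma> \<in> eval_set e m v"
  unfolding eval_set_def mem_Collect_eq
  by (rule eval_graph_mono) (auto simp: string_oracle_def nth_append)

text \<open>The nodes of a derivation of bigness are pairs of a string and a witness that it lies in the target
  set; the witness is only used at leaves.\<close>

definition big_rule :: "(nat \<Rightarrow> nat) \<Rightarrow> nat \<Rightarrow> nat \<Rightarrow> nat \<Rightarrow> nat \<Rightarrow> nat \<Rightarrow> nat set \<Rightarrow> bool" where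
  "big_rule q e k m v n D \<longleftrightarrow>
     valid (eval_rule (string_oracle (list_decode (pi1 n)))) (list_decode (pi2 n)) \<and>
       tri e m v \<in> set (list_decode (pi2 n))
   \<or> k \<le> card {i. i < q (length (list_decode (pi1 n))) \<and> (\<exists>d\<in>D. pi1 d = Suc (pr i (pi1 n)))}"

lemma mono_big_rule: "mono_rule (big_rule q e k m v)"
  unfolding mono_rule_def
proof (intro allI impI)
  fix n and D D' :: "nat set"
  assume big: "big_rule q e k m v n D" and "D \<subseteq> D'"
  then have card: "card {i. i < q (length (list_decode (pi1 n))) \<and> (\<exists>d\<in>D. pi1 d = Suc (pr i (pi1 n)))}
      \<le> card {i. i < q (length (list_decode (pi1 n))) \<and> (\<exists>d\<in>D'. pi1 d = Suc (pr i (pi1 n)))}"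
    by (intro card_mono) auto
  with big show "big_rule q e k m v n D'"
    using le_trans[OF _ card] unfolding big_rule_def by blast
qed

lemma finitary_big_rule: "finitary_rule (big_rule q e k m v)"
  unfolding finitary_rule_def
proof (intro allI impI)
  fix n D
  assume big: "big_rule q e k m v n D"
  let ?S = "\<lambda>D. {i. i < q (length (list_decode (pi1 n))) \<and> (\<exists>d\<in>D. pi1 d = Suc (pr i (pi1 n)))}"
  have "\<forall>i\<in>?S D. \<exists>d\<in>D. pi1 d = Suc (pr i (pi1 n))" by blast
  then have "\<forall>i\<in>?S D. \<exists>d. d \<in> D \<and> pi1 d = Suc (pr i (pi1 n))" by blast
  from bchoice[OF this] obtain h where h: "\<forall>i\<in>?S D. h i \<in> D \<and> pi1 (h i) = Suc (pr i (pi1 n))"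
    by (rule exE)
  have "?S (h ` ?S D) = ?S D"
    using h by (intro set_eqI) blast
  then have "big_rule q e k m v n (h ` ?S D)"
    using big unfolding big_rule_def by simp
  moreover have "h ` ?S D \<subseteq> D" "finite (h ` ?S D)" using h by auto
  ultimately show "\<exists>F\<subseteq>D. finite F \<and> big_rule q e k m v n F" by blast
qed

text \<open>Bigness becomes the existence of a finite certificate. The two sides match because
  \<open>Suc (pr i (list_encode \<sigma>))\<close> is the code of
  \<open>i # \<sigma>\<close>.\<close>

lemma big_iff_derivable:
  "big q k (eval_set e m v) \<sigma> \<longleftrightarrow> (\<exists>w. pr (list_encode \<sigma>) w \<in> derivable (big_rule q e k m v))"
proof
  assume "big q k (eval_set e m v) \<sigma>"
  then show "\<exists>w. pr (list_encode \<sigma>) w \<in> derivable (big_rule q e k m v)"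
  proof induction
    case (leaf \<sigma>)
    then obtain L where "valid (eval_rule (string_oracle \<sigma>)) L" "tri e m v \<in> set L"
      unfolding eval_set_def eval_graph_def derivable_def by blast
    then have "pr (list_encode \<sigma>) (list_encode L) \<in> derivable (big_rule q e k m v)"
      by (intro derivable_closed mono_big_rule finitary_big_rule) (simp add: big_rule_def)
    then show ?case by blast
  next
    case (node S \<sigma>)
    let ?D = "derivable (big_rule q e k m v)"
    have "S \<subseteq> {i. i < q (length \<sigma>) \<and> (\<exists>d\<in>?D. pi1 d = Suc (pr i (list_encode \<sigma>)))}"
      using node.hyps(1) node.IH by (force intro: bexI[rotated])
    then have "card S \<le> card {i. i < q (length \<sigma>) \<and> (\<exists>d\<in>?D. pi1 d = Suc (pr i (list_encode \<sigma>)))}"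
      by (intro card_mono) auto
    \<comment> \<open>At an inner node the second component is a dummy.\<close>
    then have "pr (list_encode \<sigma>) 0 \<in> ?D"
      using node.hyps(2)
      by (intro derivable_closed mono_big_rule finitary_big_rule) (simp add: big_rule_def)
    then show ?case by blast
  qed
next
  assume "\<exists>w. pr (list_encode \<sigma>) w \<in> derivable (big_rule q e k m v)"
  then obtain w L where L: "valid (big_rule q e k m v) L" "pr (list_encode \<sigma>) w \<in> set L"
    unfolding derivable_def by blast
  have "set L \<subseteq> {n. big q k (eval_set e m v) (list_decode (pi1 n))}"
  proof (rule valid_induct[OF L(1)], rule CollectI)
    fix n D
    assume n: "big_rule q e k m v n D" and D: "D \<subseteq> {n. big q k (eval_set e m v) (list_decode (pi1 n))}"
    let ?\<sigma> = "list_decode (pi1 n)"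
    let ?S = "{i. i < q (length ?\<sigma>) \<and> (\<exists>d\<in>D. pi1 d = Suc (pr i (pi1 n)))}"
    from n consider "?\<sigma> \<in> eval_set e m v" | "k \<le> card ?S"
      unfolding big_rule_def eval_set_def eval_graph_def derivable_def by blast
    then show "big q k (eval_set e m v) ?\<sigma>"
    proof cases
      case 1
      then show ?thesis by (rule big.leaf)
    next
      case 2
      have "big q k (eval_set e m v) (i # ?\<sigma>)" if "i \<in> ?S" for i
        using that D by fastforce
      with 2 show ?thesis by - (rule big.node[of ?S], auto)
    qed
  qed
  with L(2) show "big q k (eval_set e m v) \<sigma>" by auto
qed

text \<open>The coefficients \<open>a\<close> and \<open>b\<close> are read off the input, which replaces an appeal to the recursion theorem.\<close>

lemma ex_bushy_search:
  assumes q: "total_recursive q"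
  shows "\<exists>\<theta>. partial_recursive \<theta> \<and> (\<forall>a b k \<sigma> x m. x = pr a (pr b (pr k (list_encode \<sigma>))) \<longrightarrow> m = a * x + b \<longrightarrow>
    (case \<theta> x of None \<Rightarrow> \<forall>v. \<not> big q k (eval_set e m v) \<sigma> | Some v \<Rightarrow> big q k (eval_set e m v) \<sigma>))"
proof -
  \<comment> \<open>The witness w codes the value v, the second component of the root node, and a
    derivation; \<open>pi1 x * x + pi1 (pi2 x)\<close> is the place
    \<open>a * x + b\<close>.\<close>
  define P where "P x w \<longleftrightarrow>
    valid (big_rule q e (pi1 (pi2 (pi2 x))) (pi1 x * x + pi1 (pi2 x)) (pi1 w)) (list_decode (pi2 (pi2 w))) \<and>
    pr (pi2 (pi2 (pi2 x))) (pi1 (pi2 w)) \<in> set (list_decode (pi2 (pi2 w)))" for x w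
  define \<theta> where "\<theta> x = (if \<exists>w. P x w then Some (pi1 (LEAST w. P x w)) else None)" for x
  have "partial_recursive \<theta>"
    unfolding \<theta>_def[abs_def] P_def big_rule_def
    by (intro partial_recursive_search recursive_intros total_recursive_comp[OF q])
  moreover have "case \<theta> x of None \<Rightarrow> \<forall>v. \<not> big q k (eval_set e m v) \<sigma> | Some v \<Rightarrow> big q k (eval_set e m v) \<sigma>"
    if x: "x = pr a (pr b (pr k (list_encode \<sigma>)))" and m: "m = a * x + b" for a b k \<sigma> x m
  proof -
    have P: "P x w \<longleftrightarrow> valid (big_rule q e k m (pi1 w)) (list_decode (pi2 (pi2 w))) \<and>
        pr (list_encode \<sigma>) (pi1 (pi2 w)) \<in> set (list_decode (pi2 (pi2 w)))" for w
      unfolding P_def m using x by simp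
    have sound: "big q k (eval_set e m (pi1 w)) \<sigma>" if "P x w" for w
      using that unfolding P big_iff_derivable derivable_def by blast
    have complete: "\<exists>w. P x w" if big: "big q k (eval_set e m v) \<sigma>" for v
    proof -
      obtain w L where "valid (big_rule q e k m v) L" "pr (list_encode \<sigma>) w \<in> set L"
        using big unfolding big_iff_derivable derivable_def by blast
      then show ?thesis unfolding P
        by (intro exI[of _ "pr v (pr w (list_encode L))"]) simp
    qed
    show ?thesis
      using sound[OF LeastI_ex[of "P x"]] complete by (auto simp: \<theta>_def)
  qed
  ultimately show ?thesis by blast
qed

subsection \<open>A slow-growing bound with huge jumps\<close>

lemma triangle_mono: "m \<le> n \<Longrightarrow> triangle m \<le> triangle n"
  unfolding triangle_def by (intro div_le_mono mult_le_mono) auto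

lemma pr_mono: "a \<le> a' \<Longrightarrow> b \<le> b' \<Longrightarrow> pr a b \<le> pr a' b'"
  unfolding prod_encode_def by (auto intro!: add_mono triangle_mono)

text \<open>This is the code of the constant string with n entries c.\<close>

definition string_code_bound :: "nat \<Rightarrow> nat \<Rightarrow> nat" where
  "string_code_bound c n = rec_nat 0 (\<lambda>_ v. Suc (pr c v)) n"

lemma list_encode_le_string_code_bound:
  "(\<And>i. i \<in> set \<sigma> \<Longrightarrow> i \<le> c) \<Longrightarrow> list_encode \<sigma> \<le> string_code_bound c (length \<sigma>)"
proof (induction \<sigma>)
  case (Cons i \<sigma>)
  then show ?case
    using pr_mono[of i c "list_encode \<sigma>" "string_code_bound c (length \<sigma>)"]
    by (simp add: string_code_bound_def)
qed simp

text \<open>The value c i is taken on the block from N i up to N (i + 1), whose length is c i, so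
  each block adds 1 to the sum of reciprocals. The next value is chosen after the block has ended,
  hence it may exceed any computable quantity depending on strings over the earlier blocks.\<close>

lemma ex_recursive_slow_growing:
  assumes P: "total_recursive P"
  shows "\<exists>q. total_recursive q \<and> mono q \<and> (\<forall>n. 2 \<le> q n) \<and> (\<forall>r. \<exists>n. r < q n) \<and> slow_growing (\<lambda>n. real (q n)) \<and>
    (\<forall>l. \<exists>n\<ge>l. \<forall>a b k \<sigma>. a \<le> n \<longrightarrow> b \<le> n \<longrightarrow> k \<le> n \<longrightarrow> length \<sigma> = n \<longrightarrow> bounded_string q \<sigma> \<longrightarrow>
      k + P (a * pr a (pr b (pr k (list_encode \<sigma>))) + b) * k \<le> q n)"
proof -
  \<comment> \<open>The sum of P over all arguments up to m, a monotone majorant of P.\<close>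
  define S where "S m = rec_nat 0 (\<lambda>j v. v + P j) (Suc m)" for m
  define code where "code n c = pr n (pr n (pr n (string_code_bound c n)))" for n c
  \<comment> \<open>The summand \<open>c + 1\<close> makes the values strictly increase; the product
    dominates \<open>k + P m * k\<close> for all k up to n and all m up to
    \<open>n * code n c + n\<close>.\<close>
  define jump where "jump n c = c + 1 + n * (1 + S (n * code n c + n))" for n c
  \<comment> \<open>The state is the pair of block start and block value. It starts with value 2 to
    keep q above 1.\<close>
  define st where "st = rec_nat (pr 0 2) (\<lambda>_ s. pr (pi1 s + pi2 s) (jump (pi1 s + pi2 s) (pi2 s)))"
  define N where "N i = pi1 (st i)" for i
  define c where "c i = pi2 (st i)" for i
  define q where "q n = c (LEAST i. n < N (Suc i))" for n

  have N_0: "N 0 = 0" and c_0: "c 0 = 2"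
    and N_Suc: "N (Suc i) = N i + c i" and c_Suc: "c (Suc i) = jump (N (Suc i)) (c i)" for i
    by (simp_all add: N_def c_def st_def)
  have c_less: "c i < c (Suc i)" for i
    by (simp add: c_Suc jump_def)
  then have c_mono: "mono c" and c_strict: "strict_mono c"
    by (simp_all add: mono_iff_le_Suc strict_mono_Suc_iff less_imp_le)
  have c_ge: "2 \<le> c i" for i
    using monoD[OF c_mono, of 0 i] c_0 by simp
  have N_strict: "strict_mono N"
    using c_ge by (simp add: strict_mono_Suc_iff N_Suc) (metis gr0I not_numeral_le_zero)
  have N_ex: "\<exists>i. n < N (Suc i)" for n
    using strict_mono_imp_increasing[OF N_strict, of "Suc n"] by (intro exI[of _ n]) simp
  have q_eq: "q n = c i" if "N i \<le> n" "n < N (Suc i)" for n i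
  proof -
    have "(LEAST i. n < N (Suc i)) = i"
    proof (rule Least_equality)
      fix j assume "n < N (Suc j)"
      then have "N i < N (Suc j)" using that by simp
      then show "i \<le> j" using strict_mono_less[OF N_strict] by simp
    qed (rule that)
    then show ?thesis by (simp add: q_def)
  qed
  have q_N: "q (N i) = c i" for i
    by (rule q_eq) (use N_strict in \<open>simp_all add: strict_mono_def\<close>)

  have S_rec: "total_recursive (\<lambda>x. S (f x))" if "total_recursive f" for f
    unfolding S_def by (intro recursive_intros total_recursive_comp[OF P] that)
  have scb_rec: "total_recursive (\<lambda>x. string_code_bound (f x) (g x))"
    if "total_recursive f" "total_recursive g" for f g
    unfolding string_code_bound_def by (intro recursive_intros total_recursive_comp[OF that(1)] that)
  have jump_rec: "total_recursive (\<lambda>x. jump (f x) (g x))" if "total_recursive f" "total_recursive g" for f g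
    unfolding jump_def code_def by (intro recursive_intros S_rec scb_rec that)
  have "total_recursive (\<lambda>i. rec_nat (pr 0 2) (\<lambda>_ s. pr (pi1 s + pi2 s) (jump (pi1 s + pi2 s) (pi2 s))) i)"
    by (intro recursive_intros jump_rec)
  then have st_rec: "total_recursive st" by (simp add: st_def)
  have "total_recursive (\<lambda>n. LEAST i. n < N (Suc i))"
    unfolding N_def
    by (intro total_recursive_Least recursive_intros total_recursive_comp[OF st_rec] N_ex[unfolded N_def])
  then have "total_recursive q"
    unfolding q_def[abs_def] c_def
    by (intro recursive_intros total_recursive_comp[OF st_rec])
  moreover have q_mono: "mono q"
  proof
    fix m n :: nat
    assume "m \<le> n"
    then have "m < N (Suc (LEAST i. n < N (Suc i)))"
      using LeastI_ex[OF N_ex[of n]] by linarith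
    then have "(LEAST i. m < N (Suc i)) \<le> (LEAST i. n < N (Suc i))"
      by (rule Least_le)
    then show "q m \<le> q n" unfolding q_def by (rule monoD[OF c_mono])
  qed
  moreover have "\<forall>n. 2 \<le> q n" by (simp add: q_def c_ge)
  moreover have "\<forall>r. \<exists>n. r < q n"
    using strict_mono_imp_increasing[OF c_strict] q_N by (metis Suc_le_eq)
  moreover have "slow_growing (\<lambda>n. real (q n))"
  proof -
    have sum: "(\<Sum>n<N i. inverse (real (q n))) = real i" for i
    proof (induction i)
      case (Suc i)
      have "{..<N (Suc i)} = {..<N i} \<union> {N i..<N (Suc i)}"
        by (auto simp: N_Suc)
      then have "(\<Sum>n<N (Suc i). inverse (real (q n))) =
          (\<Sum>n<N i. inverse (real (q n))) + (\<Sum>n=N i..<N (Suc i). inverse (real (q n)))"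
        by (simp add: sum.union_disjoint ivl_disj_int)
      also have "(\<Sum>n=N i..<N (Suc i). inverse (real (q n))) = (\<Sum>n=N i..<N (Suc i). inverse (real (c i)))"
        by (intro sum.cong refl) (simp add: q_eq)
      also have "\<dots> = 1" using c_ge[of i] by (simp add: N_Suc)
      finally show ?case by (simp add: Suc.IH)
    qed (simp add: N_0)
    show ?thesis
      unfolding slow_growing_def filterlim_at_top
    proof
      fix Z :: real
      have "Z \<le> (\<Sum>n<m. inverse (real (q n)))" if "N (nat \<lceil>Z\<rceil>) \<le> m" for m
      proof -
        have "Z \<le> real (nat \<lceil>Z\<rceil>)" by linarith
        also have "\<dots> = (\<Sum>n<N (nat \<lceil>Z\<rceil>). inverse (real (q n)))" by (simp add: sum)
        also have "\<dots> \<le> (\<Sum>n<m. inverse (real (q n)))"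
          using that by (intro sum_mono2) auto
        finally show ?thesis .
      qed
      then show "\<forall>\<^sub>F m in sequentially. Z \<le> (\<Sum>n<m. inverse (real (q n)))"
        unfolding eventually_sequentially by blast
    qed
  qed
  moreover have "\<exists>n\<ge>l. \<forall>a b k \<sigma>. a \<le> n \<longrightarrow> b \<le> n \<longrightarrow> k \<le> n \<longrightarrow> length \<sigma> = n \<longrightarrow> bounded_string q \<sigma> \<longrightarrow>
      k + P (a * pr a (pr b (pr k (list_encode \<sigma>))) + b) * k \<le> q n" for l
  proof (intro exI[of _ "N (Suc l)"] conjI allI impI)
    show "l \<le> N (Suc l)" using strict_mono_imp_increasing[OF N_strict, of "Suc l"] by simp
    let ?n = "N (Suc l)"
    fix a b k and \<sigma> :: "nat list"
    assume a: "a \<le> ?n" and b: "b \<le> ?n" and k: "k \<le> ?n" and len: "length \<sigma> = ?n" and bd: "bounded_string q \<sigma>"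
    let ?x = "pr a (pr b (pr k (list_encode \<sigma>)))"
    \<comment> \<open>All positions of \<sigma> lie in blocks up to l, so the bound on its entries
      does not involve the new value c (l + 1).\<close>
    have "i \<le> c l" if i: "i \<in> set \<sigma>" for i
    proof -
      obtain j where j: "j < ?n" "i = rev \<sigma> ! j"
        using i len by (metis in_set_conv_nth length_rev set_rev)
      then have "i < q j" using bd len by (simp add: bounded_string_def)
      also have "q j \<le> c l"
        unfolding q_def using Least_le[of "\<lambda>i. j < N (Suc i)" l] j(1) by (intro monoD[OF c_mono])
      finally show ?thesis by simp
    qed
    then have "list_encode \<sigma> \<le> string_code_bound (c l) ?n"
      using list_encode_le_string_code_bound len by metis
    then have "?x \<le> code ?n (c l)"
      unfolding code_def using a b k by (intro pr_mono)
    then have m: "a * ?x + b \<le> ?n * code ?n (c l) + ?n"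
      using a b by (intro add_mono mult_le_mono)
    have "P j \<le> S m" if "j \<le> m" for j m
      using that unfolding S_def by (induction m) (auto simp: le_Suc_eq)
    from this[OF m] have "(1 + P (a * ?x + b)) * k \<le> (1 + S (?n * code ?n (c l) + ?n)) * ?n"
      using k by (intro mult_le_mono add_mono) auto
    also have "\<dots> \<le> jump ?n (c l)" by (simp add: jump_def)
    also have "\<dots> = q ?n" by (simp add: q_N c_Suc)
    finally show "k + P (a * ?x + b) * k \<le> q ?n" by simp
  qed
  ultimately show ?thesis by blast
qed

subsection \<open>Forcing with bushy trees\<close>

definition prefix_string :: "(nat \<Rightarrow> nat) \<Rightarrow> nat \<Rightarrow> nat list" where
  "prefix_string X n = rev (map X [0..<n])"

lemma string_oracle_prefix [simp]: "string_oracle (prefix_string X n) j v \<longleftrightarrow> j < n \<and> X j = v"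
  by (auto simp: string_oracle_def prefix_string_def)

lemma prefix_string_add: "\<exists>\<rho>. prefix_string X (n + m) = \<rho> @ prefix_string X n"
  by (simp add: prefix_string_def upt_add_eq_append[of 0 n m])

text \<open>The use principle: a finite derivation consults the oracle at finitely many places, and
  an entry u at most at \<open>pi1 (pi2 u)\<close>.\<close>

lemma eval_graph_prefix:
  assumes "eval_graph (\<lambda>j v. X j = v) e m v"
  shows "\<exists>n. prefix_string X n \<in> eval_set e m v"
proof -
  have "\<exists>n. valid (eval_rule (string_oracle (prefix_string X n))) L"
    if "valid (eval_rule (\<lambda>j v. X j = v)) L" for L
    using that
  proof (induction L)
    case (Cons u L)
    then obtain n where n: "valid (eval_rule (string_oracle (prefix_string X n))) L"
      by (metis valid.simps(2))
    let ?n = "max n (Suc (pi1 (pi2 u)))"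
    have "valid (eval_rule (string_oracle (prefix_string X ?n))) L"
      using n by (rule valid_mono[rotated]) (erule eval_rule_mono[OF _ subset_refl], simp)
    moreover have "eval_rule (\<lambda>j v. X j = v) u (set L)"
      using Cons.prems by simp
    then have "eval_rule (string_oracle (prefix_string X ?n)) u (set L)"
      by (rule eval_rule_mono[OF _ subset_refl]) simp
    ultimately have "valid (eval_rule (string_oracle (prefix_string X ?n))) (u # L)" by simp
    then show ?case by blast
  qed simp
  then show ?thesis
    using assms unfolding eval_set_def eval_graph_def derivable_def by blast
qed

text \<open>The bound of k by \<open>q (length \<sigma>)\<close> leaves room to lengthen \<sigma> by
  \<open>not_big_extend\<close>. Closure of B under extension lets a forbidden prefix be noticed at
  every later stem.\<close>

definition condition :: "(nat \<Rightarrow> nat) \<Rightarrow> nat list \<times> nat list set \<times> nat \<Rightarrow> bool" where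
  "condition q = (\<lambda>(\<sigma>, B, k). bounded_string q \<sigma> \<and> (\<forall>\<tau>\<in>B. \<forall>\<rho>. \<rho> @ \<tau> \<in> B) \<and> \<not> big q k B \<sigma> \<and> k \<le> q (length \<sigma>))"

text \<open>Proper extension makes the stems grow without bound, so that their union is a total
  sequence.\<close>

definition extends :: "nat list \<times> nat list set \<times> nat \<Rightarrow> nat list \<times> nat list set \<times> nat \<Rightarrow> bool" where
  "extends = (\<lambda>(\<sigma>, B, k) (\<sigma>', B', k'). (\<exists>\<rho>. \<rho> \<noteq> [] \<and> \<sigma>' = \<rho> @ \<sigma>) \<and> B \<subseteq> B')"

text \<open>A descending sequence of conditions is chosen that meets requirement r at stage r, and X
  is the union of the stems.\<close>

lemma generic_sequence:
  assumes c0: "condition q c0"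
    and dense: "\<And>r c. condition q c \<Longrightarrow> \<exists>c'. condition q c' \<and> extends c c' \<and> R r (fst c') (fst (snd c'))"
  shows "\<exists>X. (\<forall>n. X n < q n) \<and> (\<forall>n. prefix_string X n \<notin> fst (snd c0)) \<and>
    (\<forall>r::nat. \<exists>n B. R r (prefix_string X n) B \<and> (\<forall>n. prefix_string X n \<notin> B))"
proof -
  obtain C where C0: "C 0 = c0" and cond: "\<And>r. condition q (C r)"
    and ext: "\<And>r. extends (C r) (C (Suc r))"
    and R: "\<And>r. R r (fst (C (Suc r))) (fst (snd (C (Suc r))))"
  proof -
    have "\<exists>f. \<forall>n. (condition q (f n) \<and> (n = 0 \<longrightarrow> f n = c0)) \<and>
        (extends (f n) (f (Suc n)) \<and> R n (fst (f (Suc n))) (fst (snd (f (Suc n)))))"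
    proof (rule dependent_nat_choice)
      show "\<exists>c. condition q c \<and> (0 = (0::nat) \<longrightarrow> c = c0)" using c0 by blast
      show "\<exists>c'. (condition q c' \<and> (Suc n = 0 \<longrightarrow> c' = c0)) \<and> extends c c' \<and> R n (fst c') (fst (snd c'))"
        if "condition q c \<and> (n = 0 \<longrightarrow> c = c0)" for c n
        using that dense[of c n] by blast
    qed
    then show thesis using that by blast
  qed
  define s where "s r = fst (C r)" for r
  define B where "B r = fst (snd (C r))" for r
  have s_Suc: "\<exists>\<rho>. \<rho> \<noteq> [] \<and> s (Suc r) = \<rho> @ s r" and B_Suc: "B r \<subseteq> B (Suc r)" for r
    using ext[of r] by (auto simp: extends_def s_def B_def case_prod_beta)
  have bd: "bounded_string q (s r)" and up: "\<And>\<tau> \<rho>. \<tau> \<in> B r \<Longrightarrow> \<rho> @ \<tau> \<in> B r" and s_B: "s r \<notin> B r" for r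
    using cond[of r] by (auto simp: condition_def s_def B_def case_prod_beta intro: big.leaf)
  have B_mono: "B r \<subseteq> B t" if "r \<le> t" for r t
    using lift_Suc_mono_le[of B, OF B_Suc that] .
  have s_mono: "\<exists>\<rho>. s t = \<rho> @ s r" if "r \<le> t" for r t
    using that
  proof (induction t rule: dec_induct)
    case (step t)
    then show ?case using s_Suc[of t] by (metis append.assoc)
  qed simp
  have len: "r \<le> length (s r)" for r
  proof (induction r)
    case (Suc r)
    obtain \<rho> where "\<rho> \<noteq> []" "s (Suc r) = \<rho> @ s r" using s_Suc by blast
    then have "length (s r) < length (s (Suc r))" by simp
    with Suc show ?case by simp
  qed simp
  define X where "X j = rev (s (Suc j)) ! j" for j
  have nth: "rev (s r) ! j = X j" if "j < length (s r)" for r j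
  proof -
    have lt: "j < length (s (Suc j))" using len[of "Suc j"] by simp
    show ?thesis
    proof (cases "r \<le> Suc j")
      case True
      then obtain \<rho> where "s (Suc j) = \<rho> @ s r" using s_mono by blast
      then show ?thesis using that by (simp add: X_def nth_append)
    next
      case False
      then obtain \<rho> where "s r = \<rho> @ s (Suc j)" using s_mono[of "Suc j" r] by auto
      then show ?thesis using lt by (simp add: X_def nth_append)
    qed
  qed
  have prefix: "prefix_string X (length (s r)) = s r" for r
  proof -
    have "map X [0..<length (s r)] = rev (s r)"
      by (rule nth_equalityI) (simp_all add: nth)
    then show ?thesis by (simp add: prefix_string_def)
  qed
  \<comment> \<open>A prefix in B r would put a later stem into B r and hence into its own forbidden
    set, where it would be big as a leaf.\<close>
  have avoid: "prefix_string X n \<notin> B r" for n r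
  proof
    assume n: "prefix_string X n \<in> B r"
    let ?t = "max n r"
    obtain \<rho> where "prefix_string X (length (s ?t)) = \<rho> @ prefix_string X n"
      using prefix_string_add[of X n "length (s ?t) - n"] len[of ?t] by auto
    then have "s ?t \<in> B r" using up[OF n] by (simp add: prefix)
    then show False using s_B[of ?t] B_mono[of r ?t] by auto
  qed
  have "X j < q j" for j
  proof -
    have lt: "j < length (s (Suc j))" using len[of "Suc j"] by simp
    with bd[of "Suc j"] have "rev (s (Suc j)) ! j < q j" by (simp add: bounded_string_def)
    then show ?thesis by (simp add: nth[OF lt])
  qed
  moreover have "\<exists>n B. R r (prefix_string X n) B \<and> (\<forall>n. prefix_string X n \<notin> B)" for r
    using R[of r] prefix[of "Suc r"] avoid[of _ "Suc r"] unfolding s_def B_def by metis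
  ultimately show ?thesis
    using avoid[of _ 0] by (intro exI[of _ X]) (simp add: B_def C0)
qed

lemma ex_LUA_not_computing:
  assumes q: "mono q" "\<And>n. 2 \<le> q n"
    and jumps: "\<And>l. \<exists>n\<ge>l. \<forall>a b k \<sigma>. a \<le> n \<longrightarrow> b \<le> n \<longrightarrow> k \<le> n \<longrightarrow> length \<sigma> = n \<longrightarrow> bounded_string q \<sigma> \<longrightarrow>
      k + P (a * pr a (pr b (pr k (list_encode \<sigma>))) + b) * k \<le> q n"
    and q_rec: "total_recursive q"
    and p: "\<And>n. p n \<le> real (P n)"
  shows "\<exists>X\<in>LUA (\<lambda>n. real (q n)). \<forall>Y\<in>LUA p. \<not> turing_computes X Y"
proof -
  obtain \<psi> where \<psi>: "linearly_universal \<psi>" using ex_linearly_universal by blast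
  obtain \<Theta> where \<Theta>_rec: "\<And>e. partial_recursive (\<Theta> e)"
    and \<Theta>: "\<And>e a b k \<sigma> x m. x = pr a (pr b (pr k (list_encode \<sigma>))) \<Longrightarrow> m = a * x + b \<Longrightarrow>
      (case \<Theta> e x of None \<Rightarrow> \<forall>v. \<not> big q k (eval_set e m v) \<sigma> | Some v \<Rightarrow> big q k (eval_set e m v) \<sigma>)"
    using ex_bushy_search[OF q_rec] by metis
  define B0 where "B0 = {\<sigma>. \<exists>j<length \<sigma>. \<psi> j = Some (rev \<sigma> ! j)}"
  \<comment> \<open>Requirement r codes an index e and coefficients a, b. Each alternative rules out
    an output Y in \<open>LUA p\<close>: the first makes Y agree at m with its universal function,
    the second leaves Y no value below P m.\<close>
  define R where "R r \<sigma> B \<longleftrightarrow> (\<exists>x m. m = pi1 (pi2 r) * x + pi2 (pi2 r) \<and>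
      ((\<exists>v. \<Theta> (pi1 r) x = Some v \<and> \<sigma> \<in> eval_set (pi1 r) m v) \<or> (\<forall>v<P m. eval_set (pi1 r) m v \<subseteq> B)))"
    for r \<sigma> B

  \<comment> \<open>At each node \<psi> rules out at most one next entry, so two children cannot be
    bad unless the node already is.\<close>
  have small: "\<sigma> \<in> B0" if "big q 2 B0 \<sigma>" for \<sigma>
    using that
  proof induction
    case (node S \<sigma>)
    show ?case
    proof (rule ccontr)
      assume "\<sigma> \<notin> B0"
      then have "\<psi> (length \<sigma>) = Some i" if "i \<in> S" for i
        using node.IH[OF that] by (auto simp: B0_def nth_append less_Suc_eq)
      then have "is_singleton S \<or> S = {}"
        unfolding is_singleton_def by (metis insertI1 is_singletonI' is_singleton_def option.inject)
      then have "card S \<le> 1" by (auto simp: is_singleton_altdef)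
      then show False using node.hyps(2) by simp
    qed
  qed
  have "[] \<notin> B0" by (simp add: B0_def)
  then have "\<not> big q 2 B0 []" using small by blast
  moreover have "\<rho> @ \<tau> \<in> B0" if "\<tau> \<in> B0" for \<rho> \<tau>
    using that by (force simp: B0_def nth_append)
  ultimately have "condition q ([], B0, 2)"
    using q(2) by (simp add: condition_def)
  moreover have "\<exists>c'. condition q c' \<and> extends c c' \<and> R r (fst c') (fst (snd c'))"
    if "condition q c" for r c
  proof -
    obtain \<sigma>0 B k where c: "c = (\<sigma>0, B, k)" by (cases c)
    define e where "e = pi1 r"
    define a where "a = pi1 (pi2 r)"
    define b where "b = pi2 (pi2 r)"
    from that have bd0: "bounded_string q \<sigma>0" and up: "\<forall>\<tau>\<in>B. \<forall>\<rho>. \<rho> @ \<tau> \<in> B"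
      and small0: "\<not> big q k B \<sigma>0" and k: "k \<le> q (length \<sigma>0)"
      by (simp_all add: condition_def c)
    \<comment> \<open>The length n exceeds that of the old stem, bounds a, b and k, and is a place
      where q jumps.\<close>
    obtain n where n: "n \<ge> Suc (length \<sigma>0) + a + b + k"
      and jump: "\<And>\<sigma>. length \<sigma> = n \<Longrightarrow> bounded_string q \<sigma> \<Longrightarrow>
        k + P (a * pr a (pr b (pr k (list_encode \<sigma>))) + b) * k \<le> q n"
      using jumps[of "Suc (length \<sigma>0) + a + b + k"] by auto
    obtain \<rho> where \<rho>: "length \<rho> = n - length \<sigma>0" and bd: "bounded_string q (\<rho> @ \<sigma>0)"
      and small: "\<not> big q k B (\<rho> @ \<sigma>0)"
      using not_big_extend[OF q(1) k small0 bd0] by blast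
    define \<sigma> where "\<sigma> = \<rho> @ \<sigma>0"
    have len: "length \<sigma> = n" and "\<rho> \<noteq> []" using \<rho> n by (auto simp: \<sigma>_def)
    define x where "x = pr a (pr b (pr k (list_encode \<sigma>)))"
    define m where "m = a * x + b"
    show ?thesis
    proof (cases "\<Theta> e x")
      case None
      then have A: "\<And>v. \<not> big q k (eval_set e m v) \<sigma>"
        using \<Theta>[OF x_def m_def, of e] by simp
      define B' where "B' = B \<union> (\<Union>v<P m. eval_set e m v)"
      \<comment> \<open>Each of the P m values costs k, and the jump of q at n pays for the
        total.\<close>
      have "\<not> big q (k + P m * k) B' \<sigma>"
        unfolding B'_def by (rule not_big_UN) (use small A in \<open>simp_all add: \<sigma>_def\<close>)
      moreover have "k + P m * k \<le> q (length \<sigma>)"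
        using jump[OF len] bd by (simp add: len m_def x_def flip: \<sigma>_def)
      moreover have "\<forall>\<tau>\<in>B'. \<forall>\<rho>. \<rho> @ \<tau> \<in> B'"
        using up unfolding B'_def by (auto intro: eval_set_append)
      ultimately have "condition q (\<sigma>, B', k + P m * k)"
        using bd by (simp add: condition_def \<sigma>_def)
      moreover have "extends c (\<sigma>, B', k + P m * k)"
        using \<open>\<rho> \<noteq> []\<close> by (auto simp: extends_def c \<sigma>_def B'_def)
      moreover have "R r \<sigma> B'"
        unfolding R_def B'_def e_def[symmetric] a_def[symmetric] b_def[symmetric]
        by (intro exI[of _ x] exI[of _ m]) (auto simp: m_def)
      ultimately show ?thesis by (intro exI[of _ "(\<sigma>, B', k + P m * k)"]) simp
    next
      case (Some v)
      then have "big q k (eval_set e m v) \<sigma>"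
        using \<Theta>[OF x_def m_def, of e] by simp
      then obtain \<rho>' where \<rho>': "\<rho>' @ \<sigma> \<in> eval_set e m v" "bounded_string q (\<rho>' @ \<sigma>)" "\<not> big q k B (\<rho>' @ \<sigma>)"
        using big_not_big_leaf small bd unfolding \<sigma>_def by blast
      have "k \<le> q (length (\<rho>' @ \<sigma>))"
        using k monoD[OF q(1), of "length \<sigma>0" "length (\<rho>' @ \<sigma>)"] by (simp add: \<sigma>_def)
      then have "condition q (\<rho>' @ \<sigma>, B, k)"
        using \<rho>' up by (simp add: condition_def)
      moreover have "extends c (\<rho>' @ \<sigma>, B, k)"
        using \<open>\<rho> \<noteq> []\<close> by (simp add: extends_def c \<sigma>_def)
      moreover have "R r (\<rho>' @ \<sigma>) B"
        unfolding R_def e_def[symmetric] a_def[symmetric] b_def[symmetric]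
        using Some \<rho>'(1) m_def by blast
      ultimately show ?thesis by (intro exI[of _ "(\<rho>' @ \<sigma>, B, k)"]) simp
    qed
  qed
  ultimately obtain X where X: "\<And>n. X n < q n" "\<And>n. prefix_string X n \<notin> B0"
    and R: "\<And>r. \<exists>n B. R r (prefix_string X n) B \<and> (\<forall>n. prefix_string X n \<notin> B)"
    using generic_sequence[of q "([], B0, 2)" R] by auto
  have "\<psi> n \<noteq> Some (X n)" for n
    using X(2)[of "Suc n"] unfolding B0_def prefix_string_def
    by (auto simp: nth_append simp flip: map_append)
  then have "X \<in> LUA (\<lambda>n. real (q n))"
    using X(1) \<psi> unfolding LUA_def by auto
  moreover have "\<not> turing_computes X Y" if Y: "Y \<in> LUA p" for Y
  proof
    assume "turing_computes X Y"
    then have "partial_recursive_in {X} (\<lambda>x. Some (Y x))"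
      by (simp add: turing_computes_def)
    from partial_recursive_in_eval_graph[OF this, of "\<lambda>j v. X j = v"]
    obtain e where e: "\<And>x v. Y x = v \<longleftrightarrow> eval_graph (\<lambda>j v. X j = v) e x v"
      by auto
    obtain \<psi>' where \<psi>': "linearly_universal \<psi>'" "\<And>n. \<psi>' n \<noteq> Some (Y n)"
      using Y unfolding LUA_def by blast
    \<comment> \<open>The construction has treated all triples e, a, b, in particular the
      coefficients at which \<psi>' simulates the search for e.\<close>
    then obtain a b where ab: "\<And>x. \<psi>' (a * x + b) = \<Theta> e x"
      using \<Theta>_rec unfolding linearly_universal_def by metis
    obtain n B where RB: "R (pr e (pr a b)) (prefix_string X n) B" and B: "\<And>n. prefix_string X n \<notin> B"
      using R by blast
    then obtain x m where m: "m = a * x + b"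
      and or: "(\<exists>v. \<Theta> e x = Some v \<and> prefix_string X n \<in> eval_set e m v) \<or> (\<forall>v<P m. eval_set e m v \<subseteq> B)"
      unfolding R_def by (simp only: prod_encode_inverse fst_conv snd_conv) blast
    from or show False
    proof (elim disjE exE conjE)
      fix v
      assume "\<Theta> e x = Some v" "prefix_string X n \<in> eval_set e m v"
      then have "eval_graph (\<lambda>j v. X j = v) e m v"
        unfolding eval_set_def by (auto intro: eval_graph_mono[rotated])
      then have "Y m = v" using e by blast
      with \<open>\<Theta> e x = Some v\<close> ab[of x] \<psi>'(2)[of m] m show False by simp
    next
      assume "\<forall>v<P m. eval_set e m v \<subseteq> B"
      moreover have "real (Y m) < p m" using Y by (auto simp: LUA_def)
      then have "Y m < P m" using p[of m] by linarith
      \<comment> \<open>Some prefix of X already forces the value Y m, which is below P m, so this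
        prefix would be forbidden.\<close>
      moreover obtain n where "prefix_string X n \<in> eval_set e m (Y m)"
        using eval_graph_prefix e by blast
      ultimately show False using B by blast
    qed
  qed
  ultimately show ?thesis by blast
qed

section \<open>From computable reals to recursive bounds, and the conclusion\<close>

lemma uniformly_computable_reals_bounded:
  assumes "uniformly_computable_reals p"
  shows "\<exists>P. total_recursive P \<and> (\<forall>n. p n \<le> real (P n))"
proof -
  obtain a b c where a: "total_recursive a"
    and approx: "\<And>n k. \<bar>p n - (real (a (pr n k)) - real (b (pr n k))) / (real (c (pr n k)) + 1)\<bar> \<le> 1 / 2 ^ k"
    using assms unfolding uniformly_computable_reals_def by blast
  \<comment> \<open>At precision k = 0 the error is at most 1, and dropping b and the denominator,
    which is at least 1, cannot decrease the approximation.\<close>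
  have "p n \<le> real (a (pr n 0) + 1)" for n
  proof -
    have "(real (a (pr n 0)) - real (b (pr n 0))) / (real (c (pr n 0)) + 1) \<le> real (a (pr n 0)) / (real (c (pr n 0)) + 1)"
      by (intro divide_right_mono) auto
    also have "\<dots> \<le> real (a (pr n 0))"
      by (simp add: divide_le_eq mult_left_le[of 1] ring_distribs)
    finally show ?thesis using approx[of n 0] by simp
  qed
  moreover have "total_recursive (\<lambda>n. a (pr n 0) + 1)"
    by (intro recursive_intros total_recursive_comp[OF a])
  ultimately show ?thesis by blast
qed

lemma uniformly_computable_reals_of_nat:
  assumes "total_recursive q"
  shows "uniformly_computable_reals (\<lambda>n. real (q n))"
  unfolding uniformly_computable_reals_def
proof (intro exI conjI allI)
  show "total_recursive (\<lambda>z. q (pi1 z))"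
    by (intro recursive_intros total_recursive_comp[OF assms])
qed (auto intro: total_recursive_const[of 0])

lemma not_LUA_weakly_reducible_LUA_slow:
  assumes "uniformly_computable_reals p"
  shows "\<not> LUA p \<le>\<^sub>w LUA_slow"
proof -
  obtain P where P: "total_recursive P" "\<And>n. p n \<le> real (P n)"
    using uniformly_computable_reals_bounded[OF assms] by blast
  obtain q where q: "total_recursive q" "mono q" "\<And>n. 2 \<le> q n" "\<And>r. \<exists>n. r < q n" "slow_growing (\<lambda>n. real (q n))"
    and jumps: "\<And>l. \<exists>n\<ge>l. \<forall>a b k \<sigma>. a \<le> n \<longrightarrow> b \<le> n \<longrightarrow> k \<le> n \<longrightarrow> length \<sigma> = n \<longrightarrow> bounded_string q \<sigma> \<longrightarrow>
      k + P (a * pr a (pr b (pr k (list_encode \<sigma>))) + b) * k \<le> q n"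
    using ex_recursive_slow_growing[OF P(1)] by blast
  have "order_function (\<lambda>n. real (q n))"
    unfolding order_function_def
  proof (intro conjI allI)
    show "mono (\<lambda>n. real (q n))" using q(2) by (simp add: mono_def)
    fix r :: real
    obtain n where "nat \<lceil>r\<rceil> < q n" using q(4) by blast
    then have "r < real (q n)" by linarith
    then show "\<exists>n. r < real (q n)" ..
  qed (rule uniformly_computable_reals_of_nat[OF q(1)])
  moreover have "1 < real (q n)" for n using q(3)[of n] by linarith
  ultimately have "LUA (\<lambda>n. real (q n)) \<subseteq> LUA_slow"
    using q(5) unfolding LUA_slow_def by blast
  moreover obtain X where "X \<in> LUA (\<lambda>n. real (q n))" "\<forall>Y\<in>LUA p. \<not> turing_computes X Y"
    using ex_LUA_not_computing[OF q(2,3) jumps q(1) P(2)] by blast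
  ultimately show ?thesis unfolding weakly_reducible_def by blast
qed

theorem mainTheorem8:
  "\<not> (\<exists>q :: nat \<Rightarrow> real. order_function q \<and> (\<forall>n. 1 < q n) \<and> LUA_slow \<equiv>\<^sub>w LUA q)"
  \<comment> \<open>An equivalence would include the reduction of \<open>LUA q\<close> to
    \<open>LUA_slow\<close>, which fails for every computable bound.\<close>
  using not_LUA_weakly_reducible_LUA_slow
  unfolding weakly_equivalent_def order_function_def by blast

end
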